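(* Let $n\ge1$, $0<\gamma<1$, and let $f$ be a normalized biholomorphic starlike mapping of order $\gamma$ on $\mathbb B^n$. (1) If $z\in\mathbb B^n\setminus\{0\}$ satisfies $\|f(z)\|=\max_{\|\xi\|=\|z\|}\|f(\xi)\|$, then $$|\det J_f(z)|\le(1-\|z\|)^{2(\gamma-1)n}\left(\frac{1-\|z\|}{1+(1-2\gamma)\|z\|}\right)^{-\frac{n+1}{2}}$$ and for every $\delta\in T_z^{(1,0)}(\partial\mathbb B^n(0,\|z\|))$ $$\|J_f(z)\delta\|\le(1-\|z\|)^{2(\gamma-1)}\left(\frac{1-\|z\|}{1+(1-2\gamma)\|z\|}\right)^{-\frac12}\|\delta\|.$$ (2) If $z\in\mathbb B^n\setminus\{0\}$ satisfies $\|f(z)\|=\min_{\|\xi\|=\|z\|}\|f(\xi)\|$, then $$|\det J_f(z)|\ge(1+\|z\|)^{-2(1-\gamma)n}\left(\frac{1+\|z\|}{1-(1-2\gamma)\|z\|}\right)^{-\frac{n+1}{2}}$$ and for every $\delta\in T_z^{(1,0)}(\partial\mathbb B^n(0,\|z\|))$ $$\|J_f(z)\delta\|\ge(1+\|z\|)^{-2(1-\gamma)}\left(\frac{1+\|z\|}{1-(1-2\gamma)\|z\|}\right)^{-\frac12}\|\delta\|.$$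
   Context: $\mathbb B^n$ is the open Euclidean unit ball of $\mathbb C^n$ with inner product $\langle z,w\rangle=\sum_j z_j\overline{w_j}$ and norm $\|z\|=\sqrt{\langle z,z\rangle}$; $\mathbb D=\mathbb B^1$; $\partial\mathbb B^n(0,r)=\{z:\|z\|=r\}$. $J_f(z)$ is the complex Jacobian matrix of $f$ at $z$. Normalized means $f(0)=0$ and $J_f(0)=I_n$. Holomorphic tangent space: for $z\ne0$, $T_z^{(1,0)}(\partial\mathbb B^n(0,\|z\|))=\{w\in\mathbb C^n:\ \sum_j\overline{z_j}w_j=0\}$. A normalized biholomorphic mapping $f:\mathbb B^n\to\mathbb C^n$ is starlike of order $\gamma$ ($0<\gamma<1$) if $$\frac{1}{\|z\|^2}\left\langle [J_f(z)]^{-1}f(z),z\right\rangle\in g(\mathbb D)\ \text{ for all } z\in\mathbb B^n\setminus\{0\},\qquad g(\zeta)=\frac{1-\zeta}{1+(1-2\gamma)\zeta},$$ i.e. the left-hand quantity lies in the open disc with centre $\frac1{2\gamma}$ and radius $\frac{1}{2\gamma}$. *)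

theory Defs
  imports "HOL-Complex_Analysis.Complex_Analysis"
begin

(* The library inner product on complex ^ 'n is the real part of cinner;
   the library norm is the Hermitian norm, see norm_eq_sqrt_cinner below. *)
definition cinner :: "complex ^ 'n \<Rightarrow> complex ^ 'n \<Rightarrow> complex" where
  "cinner z w = (\<Sum>j\<in>UNIV. z $ j * cnj (w $ j))"

lemma norm_eq_sqrt_cinner: "norm z = sqrt (Re (cinner z z))"
  by (simp add: cinner_def norm_vec_def L2_set_def complex_mult_cnj cmod_power2)

(* Holomorphy in several variables: the real Frechet derivative exists at every
   point and is complex linear, i.e. given by a complex matrix. Only meant for open S. *)
definition holomorphic_map_on :: "(complex ^ 'n \<Rightarrow> complex ^ 'm) \<Rightarrow> (complex ^ 'n) set \<Rightarrow> bool"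
  where "holomorphic_map_on f S \<longleftrightarrow>
    (\<forall>z\<in>S. \<exists>A :: complex ^ 'n ^ 'm. (f has_derivative (\<lambda>h. A *v h)) (at z))"

(* Biholomorphic onto the image f ` S, which need not be the whole space. *)
definition biholomorphic_map_on :: "(complex ^ 'n \<Rightarrow> complex ^ 'n) \<Rightarrow> (complex ^ 'n) set \<Rightarrow> bool"
  where "biholomorphic_map_on f S \<longleftrightarrow>
    holomorphic_map_on f S \<and> inj_on f S \<and> open (f ` S) \<and>
    holomorphic_map_on (inv_into S f) (f ` S)"

definition complex_jacobian ::
    "(complex ^ 'n \<Rightarrow> complex ^ 'm) \<Rightarrow> complex ^ 'n \<Rightarrow> complex ^ 'n ^ 'm"
  where "complex_jacobian f z = (\<chi> i j. deriv (\<lambda>\<zeta>. f (z + \<zeta> *s axis j 1) $ i) 0)"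

lemma complex_jacobian_eqI:
  fixes A :: "complex ^ 'n ^ 'm"
  assumes "(f has_derivative (\<lambda>h. A *v h)) (at z)"
  shows "complex_jacobian f z = A"
proof -
  have "deriv (\<lambda>\<zeta>. f (z + \<zeta> *s axis j 1) $ i) 0 = A $ i $ j" for i j
  proof (rule DERIV_imp_deriv)
    have lin: "linear (\<lambda>\<zeta>::complex. \<zeta> *s (axis j 1 :: complex ^ 'n))"
      by (rule linearI) (simp_all add: vec_eq_iff algebra_simps)
    have "((\<lambda>\<zeta>. z + \<zeta> *s axis j 1) has_derivative (\<lambda>\<zeta>. \<zeta> *s axis j 1)) (at 0)"
      using has_derivative_add[OF has_derivative_const linear_imp_has_derivative[OF lin]]
      by simp
    moreover have "(f has_derivative (\<lambda>h. A *v h)) (at (z + 0 *s axis j 1))"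
      using assms by simp
    ultimately have "((\<lambda>\<zeta>. f (z + \<zeta> *s axis j 1)) has_derivative
        (\<lambda>\<zeta>. A *v (\<zeta> *s axis j 1))) (at 0)"
      by (rule has_derivative_compose)
    then have "((\<lambda>\<zeta>. f (z + \<zeta> *s axis j 1) $ i) has_derivative
        (\<lambda>\<zeta>. (A *v (\<zeta> *s axis j 1)) $ i)) (at 0)"
      by (rule bounded_linear.has_derivative[OF bounded_linear_vec_nth])
    moreover have "(A *v (\<zeta> *s axis j 1)) $ i = A $ i $ j * \<zeta>" for \<zeta>
      by (simp add: matrix_vector_mult_def axis_def if_distrib cong: if_cong)
    ultimately show "((\<lambda>\<zeta>. f (z + \<zeta> *s axis j 1) $ i) has_field_derivative A $ i $ j) (at 0)"
      by (simp add: has_field_derivative_def)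
  qed
  then show ?thesis
    by (simp add: complex_jacobian_def vec_eq_iff)
qed

definition normalized_map :: "(complex ^ 'n \<Rightarrow> complex ^ 'n) \<Rightarrow> bool" where
  "normalized_map f \<longleftrightarrow> f 0 = 0 \<and> complex_jacobian f 0 = mat 1"

definition starlike_of_order :: "real \<Rightarrow> (complex ^ 'n \<Rightarrow> complex ^ 'n) \<Rightarrow> bool" where
  "starlike_of_order \<gamma> f \<longleftrightarrow>
    normalized_map f \<and> biholomorphic_map_on f (ball 0 1) \<and>
    (\<forall>z\<in>ball 0 1 - {0}.
      1 / (of_real (norm z))\<^sup>2 * cinner (matrix_inv (complex_jacobian f z) *v f z) z
        \<in> (\<lambda>\<zeta>::complex. (1 - \<zeta>) / (1 + (1 - 2 * of_real \<gamma>) * \<zeta>)) ` ball 0 1)"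

(* T_z^(1,0) of the sphere of radius norm z about the origin, for z \<noteq> 0 *)
definition holomorphic_tangent_space :: "complex ^ 'n \<Rightarrow> (complex ^ 'n) set" where
  "holomorphic_tangent_space z = {w. (\<Sum>j\<in>UNIV. cnj (z $ j) * w $ j) = 0}"

end

theory Submission
  imports Defs
begin

text \<open>At a point \<open>z\<close> where \<open>\<bar>f\<bar>\<close> is extremal on its sphere, \<open>J\<^sup>* f(z) = \<lambda> z\<close> with \<open>\<lambda>\<close> real, so
  \<open>\<langle>J\<^sup>-\<^sup>1 f(z), z\<rangle> = \<bar>f(z)\<bar>\<^sup>2 / \<lambda>\<close>, which the Schwarz lemma confines to an interval. The complex
  second-order condition at a maximum is \<open>\<bar>J \<delta>\<bar>\<^sup>2 \<le> \<lambda> \<bar>\<delta>\<bar>\<^sup>2\<close> for tangent \<open>\<delta>\<close>; a minimum of \<open>\<bar>f\<bar>\<close> is a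
  maximum of \<open>\<bar>f\<^sup>-\<^sup>1\<bar>\<close> on the sphere through \<open>f(z)\<close>. Since \<open>J\<close> maps \<open>z\<^sup>\<bottom>\<close> to \<open>f(z)\<^sup>\<bottom>\<close>, its
  determinant is bounded by the tangential stretching and the factor \<open>\<lambda> \<bar>z\<bar> / \<bar>f(z)\<bar>\<close> in the
  normal direction. Finally \<open>\<lambda>\<close> is estimated by the growth of \<open>\<bar>f\<bar>\<close>, which follows from the same
  radial information at extremal points.\<close>

section \<open>The Hermitian inner product and holomorphic curves\<close>

text \<open>Put Q = |f(z)|/|z| and P = <J^-1 f(z), z>/|z|^2, so that the multiplier is Q^2/P. The
  n-1 tangential factors sqrt(Q^2/P) and the normal factor Q/P multiply to Q^n P^(-(n+1)/2), which
  explains the exponents of the theorem: the growth estimate bounds Q, the Schwarz lemma bounds P,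
  and both enter monotonically. The exponent 2(\<gamma>-1) arises because at an extremal point the
  logarithmic radial derivative of |f| is 1/P. At a maximum it is at most (1+(1-2\<gamma>)r)/(1-r) =
  1 + 2(1-\<gamma>)r/(1-r), and integration against dr/r gives r(1-r)^(2(\<gamma>-1)); at a minimum
  r is replaced by -r in the two fractions. The obstacle is regularity:
  \<open>holomorphic_map_on\<close> only provides a complex linear derivative at each point, with no
  continuity of the Jacobian and no second derivatives. All further regularity is obtained by
  restricting to complex lines and using one-variable tools: the maximum principle, removable
  singularities and uniform limits of holomorphic functions.\<close>

lemma cinner_add_left: "cinner (x + y) w = cinner x w + cinner y w"
  by (simp add: cinner_def algebra_simps sum.distrib)

lemma cinner_diff_left: "cinner (x - y) w = cinner x w - cinner y w"
  by (simp add: cinner_def algebra_simps sum_subtractf)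

lemma cinner_add_right: "cinner w (x + y) = cinner w x + cinner w y"
  by (simp add: cinner_def algebra_simps sum.distrib)

lemma cinner_scale_left: "cinner (c *s x) w = c * cinner x w"
  by (simp add: cinner_def algebra_simps sum_distrib_left)

lemma cinner_scale_right: "cinner x (c *s w) = cnj c * cinner x w"
  by (simp add: cinner_def algebra_simps sum_distrib_left)

lemma cinner_commute: "cinner x y = cnj (cinner y x)"
  by (simp add: cinner_def mult.commute)

lemma cinner_zero_left [simp]: "cinner 0 w = 0"
  by (simp add: cinner_def)

lemma Re_cinner: "Re (cinner x y) = x \<bullet> y"
  by (simp add: cinner_def inner_vec_def inner_complex_def)

lemma cinner_self: "cinner x x = of_real ((norm x)\<^sup>2)"
proof -
  have "Im (cinner x x) = 0"
    by (simp add: cinner_def)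
  then show ?thesis
    by (simp add: complex_eq_iff Re_cinner power2_norm_eq_inner)
qed

lemma scaleR_eq_vector_scalar: "r *\<^sub>R x = (of_real r :: complex) *s (x :: complex ^ 'n)"
  by (simp add: vec_eq_iff complex_eq_iff)

lemma norm_vector_scalar: "norm (c *s x) = cmod c * norm (x :: complex ^ 'n)"
  by (simp add: norm_vec_def norm_mult L2_set_right_distrib)

lemma power2_norm_add_cinner:
  "(norm (x + y))\<^sup>2 = (norm x)\<^sup>2 + (norm y)\<^sup>2 + 2 * Re (cinner x y)"
  by (simp add: power2_norm_eq_inner inner_add Re_cinner inner_commute)

lemma bounded_linear_cinner_left: "bounded_linear (\<lambda>x. cinner x w)"
  by (intro linear_conv_bounded_linear[THEN iffD1] linearI)
    (simp_all add: cinner_add_left scaleR_eq_vector_scalar cinner_scale_left scaleR_conv_of_real)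

lemma has_derivative_line:
  "((\<lambda>\<zeta>. a + \<zeta> *s v) has_derivative (\<lambda>h. h *s v)) (at (\<zeta> :: complex))"
proof -
  have "linear (\<lambda>\<zeta>::complex. \<zeta> *s v)"
    by (rule linearI) (simp_all add: vec_eq_iff algebra_simps)
  from linear_imp_has_derivative[OF this] show ?thesis
    using has_derivative_add[OF has_derivative_const] by fastforce
qed

text \<open>A holomorphic curve with values in a complex vector space is encoded by a derivative of
  the form \<open>\<lambda>h. h *s d\<close>. The chain rule preserves this form because
  \<open>A\<close> is complex linear, so maps of several variables become one-variable objects along
  such curves.\<close>

lemma has_derivative_holomorphic_curve:
  assumes "(\<phi> has_derivative (\<lambda>h. h *s d)) (at (\<zeta> :: complex))"
    and "(F has_derivative (\<lambda>h. A *v h)) (at (\<phi> \<zeta>))"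
  shows "((\<lambda>\<zeta>. F (\<phi> \<zeta>)) has_derivative (\<lambda>h. h *s (A *v d))) (at \<zeta>)"
  using has_derivative_compose[OF assms] by (simp add: vector_scalar_commute)

lemma has_field_derivative_cinner_curve:
  assumes "(\<phi> has_derivative (\<lambda>h. h *s d)) (at (\<zeta> :: complex))"
  shows "((\<lambda>\<zeta>. cinner (\<phi> \<zeta>) u) has_field_derivative cinner d u) (at \<zeta>)"
  using bounded_linear.has_derivative[OF bounded_linear_cinner_left assms, of u]
  by (simp add: has_field_derivative_def cinner_scale_left mult_commute_abs)

lemma has_derivative_complex_jacobian:
  assumes "holomorphic_map_on f S" "z \<in> S"
  shows "(f has_derivative (\<lambda>h. complex_jacobian f z *v h)) (at z)"
  using assms complex_jacobian_eqI unfolding holomorphic_map_on_def by metis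

lemma holomorphic_map_on_imp_continuous_on:
  assumes "holomorphic_map_on f S"
  shows "continuous_on S f"
  using has_derivative_complex_jacobian[OF assms] has_derivative_continuous
  by (blast intro: continuous_at_imp_continuous_on)

section \<open>Partial derivatives of holomorphic functions of two variables\<close>

lemma norm_le_on_disc_of_norm_le_on_sphere:
  fixes f :: "complex \<Rightarrow> complex"
  assumes hol: "f holomorphic_on S" and S: "open S" "cball 0 r \<subseteq> S" and "0 < r"
    and B: "\<And>z. cmod z = r \<Longrightarrow> cmod (f z) \<le> B" and z: "cmod z \<le> r"
  shows "cmod (f z) \<le> B"
proof (rule maximum_modulus_frontier[of f "cball 0 r"])
  show "f holomorphic_on interior (cball 0 r)"
    using hol S(2) by (metis holomorphic_on_subset interior_subset order_trans)
  show "continuous_on (closure (cball 0 r)) f"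
    using holomorphic_on_imp_continuous_on[OF hol] S(2) by (simp add: continuous_on_subset)
qed (use B z \<open>0 < r\<close> in auto)

text \<open>The singularity at 0 is removable, so the maximum principle applies to the quotient
  itself. On the circle the numerator is at most \<open>2 * B\<close> and the denominator has
  modulus \<open>r\<close>.\<close>

lemma difference_quotient_bound:
  fixes f :: "complex \<Rightarrow> complex"
  assumes hol: "f holomorphic_on S" and S: "open S" "cball 0 r \<subseteq> S" and "0 < r"
    and B: "\<And>z. cmod z = r \<Longrightarrow> cmod (f z) \<le> B" and z: "cmod z \<le> r"
  shows "cmod (if z = 0 then deriv f 0 else (f z - f 0) / z) \<le> 2 * B / r"
proof (rule norm_le_on_disc_of_norm_le_on_sphere[OF _ S \<open>0 < r\<close> _ z])
  have "0 \<in> interior S"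
    using S \<open>0 < r\<close> by (auto simp: interior_open)
  from pole_lemma[OF hol this]
  show "(\<lambda>z. if z = 0 then deriv f 0 else (f z - f 0) / z) holomorphic_on S"
    by (simp cong: if_cong)
  fix z :: complex assume zr: "cmod z = r"
  have "cmod (f 0) \<le> B"
    by (rule norm_le_on_disc_of_norm_le_on_sphere[OF hol S \<open>0 < r\<close> B]) (use \<open>0 < r\<close> in auto)
  then have "cmod (f z - f 0) \<le> 2 * B"
    using B[OF zr] norm_triangle_ineq4[of "f z" "f 0"] by simp
  then show "cmod (if z = 0 then deriv f 0 else (f z - f 0) / z) \<le> 2 * B / r"
    using zr \<open>0 < r\<close> by (auto simp: norm_divide divide_right_mono)
qed

text \<open>The previous bound is applied a second time, to the difference quotient
  \<open>k\<close>, which is at most \<open>2 * B / r\<close> on the circle. The resulting constant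
  depends on \<open>f\<close> only through \<open>B\<close>, so the rate is uniform in families with
  a common bound.\<close>

lemma difference_quotient_rate:
  fixes f :: "complex \<Rightarrow> complex"
  assumes hol: "f holomorphic_on S" and S: "open S" "cball 0 r \<subseteq> S" and "0 < r"
    and B: "\<And>z. cmod z = r \<Longrightarrow> cmod (f z) \<le> B" and z: "cmod z \<le> r" "z \<noteq> 0"
  shows "cmod ((f z - f 0) / z - deriv f 0) \<le> 4 * B / r\<^sup>2 * cmod z"
proof -
  define k where "k z = (if z = 0 then deriv f 0 else (f z - f 0) / z)" for z
  have "0 \<in> interior S"
    using S \<open>0 < r\<close> by (auto simp: interior_open)
  from pole_lemma[OF hol this] have "k holomorphic_on S"
    by (simp add: k_def[abs_def] cong: if_cong)
  moreover have "cmod (k z) \<le> 2 * B / r" if "cmod z = r" for z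
    unfolding k_def by (rule difference_quotient_bound[OF hol S \<open>0 < r\<close> B]) (use that in auto)
  ultimately have "cmod (if z = 0 then deriv k 0 else (k z - k 0) / z) \<le> 2 * (2 * B / r) / r"
    using difference_quotient_bound[OF _ S \<open>0 < r\<close> _ z(1)] by blast
  then have "cmod (k z - k 0) \<le> 4 * B / r\<^sup>2 * cmod z"
    using z by (simp add: norm_divide field_simps power2_eq_square)
  then show ?thesis
    using z(2) by (simp add: k_def)
qed

text \<open>The derivative in the second variable is a uniform limit of difference quotients that
  are holomorphic in the first. Their derivatives converge too, and these are difference quotients
  in \<open>t\<close> of the other partial derivative, which yields the exchange of the two
  derivatives as soon as the second mixed one exists.\<close>

lemma
  fixes F :: "complex \<Rightarrow> complex \<Rightarrow> complex"
  assumes W: "open W" and cont: "continuous_on W (\<lambda>(x, t). F x t)"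
    and diff1: "\<And>x t. (x, t) \<in> W \<Longrightarrow> (\<lambda>x. F x t) field_differentiable (at x)"
    and diff2: "\<And>x t. (x, t) \<in> W \<Longrightarrow> F x field_differentiable (at t)"
  shows partial_deriv_field_differentiable:
      "\<And>x. (x, 0) \<in> W \<Longrightarrow> (\<lambda>x. deriv (F x) 0) field_differentiable (at x)"
    and deriv_partial_deriv_swap:
      "\<And>x d. (x, 0) \<in> W \<Longrightarrow> ((\<lambda>t. deriv (\<lambda>x. F x t) x) has_field_derivative d) (at 0)
        \<Longrightarrow> deriv (\<lambda>x. deriv (F x) 0) x = d"
proof -
  define G where "G x = deriv (F x) 0" for x
  have main: "\<exists>d. (G has_field_derivative d) (at x0) \<and>
      (\<forall>d'. ((\<lambda>t. deriv (\<lambda>x. F x t) x0) has_field_derivative d') (at 0) \<longrightarrow> d = d')"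
    if x0: "(x0, 0) \<in> W" for x0
  proof -
    obtain A0 B0 where AB: "open A0" "open B0" "x0 \<in> A0" "0 \<in> B0" "A0 \<times> B0 \<subseteq> W"
      using open_prod_elim[OF W x0] by (metis mem_Sigma_iff)
    obtain e1 where e1: "e1 > 0" "cball x0 e1 \<subseteq> A0"
      using AB by (meson open_contains_cball)
    obtain e2 where e2: "e2 > 0" "cball 0 e2 \<subseteq> B0"
      using AB by (meson open_contains_cball)
    have sub: "cball x0 e1 \<times> cball 0 e2 \<subseteq> W"
      using Sigma_mono[OF e1(2) e2(2)] AB(5) by (rule order_trans)
    have "compact ((\<lambda>(x, t). F x t) ` (cball x0 e1 \<times> cball 0 e2))"
      by (rule compact_continuous_image[OF continuous_on_subset[OF cont sub]])
        (rule compact_Times[OF compact_cball compact_cball])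
    then obtain B where "\<forall>y\<in>(\<lambda>(x, t). F x t) ` (cball x0 e1 \<times> cball 0 e2). cmod y \<le> B"
      using compact_imp_bounded[THEN bounded_iff[THEN iffD1]] by blast
    then have B: "cmod (F x t) \<le> B" if "x \<in> cball x0 e1" "t \<in> cball 0 e2" for x t
      using bspec[of _ _ "F x t"] that by auto
    define C where "C = 4 * B / e2\<^sup>2"
    \<comment> \<open>\<open>C\<close> does not depend on \<open>x\<close>: the bound
      \<open>B\<close> holds on the whole product of closed discs.\<close>
    have rate: "cmod ((F x t - F x 0) / t - G x) \<le> C * cmod t"
      if "x \<in> cball x0 e1" "cmod t \<le> e2" "t \<noteq> 0" for x t
      unfolding C_def G_def
    proof (rule difference_quotient_rate[OF _ AB(2) e2(2,1) _ that(2,3)])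
      show "cmod (F x t) \<le> B" if "cmod t = e2" for t
        using B[OF \<open>x \<in> cball x0 e1\<close>] that by simp
    next
      show "F x holomorphic_on B0"
        unfolding holomorphic_on_def
      proof
        fix t assume "t \<in> B0"
        with that(1) e1(2) AB(5) have "(x, t) \<in> W" by auto
        then show "F x field_differentiable at t within B0"
          by (rule field_differentiable_at_within[OF diff2])
      qed
    qed
    define \<tau> where "\<tau> n = complex_of_real (e2 / (real n + 1))" for n
    have \<tau>: "cmod (\<tau> n) \<le> e2" "\<tau> n \<noteq> 0" for n
    proof -
      have "e2 / (real n + 1) \<le> e2 / 1" "e2 / (real n + 1) > 0"
        using e2(1) by (auto intro!: divide_left_mono divide_pos_pos simp del: div_by_1)
      then show "cmod (\<tau> n) \<le> e2" "\<tau> n \<noteq> 0"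
        unfolding \<tau>_def norm_of_real of_real_eq_0_iff by linarith+
    qed
    have \<tau>0: "\<tau> \<longlonglongrightarrow> 0"
    proof -
      have "(\<lambda>n. e2 / (real n + 1)) \<longlonglongrightarrow> 0"
        by real_asymp
      from tendsto_of_real[OF this, where 'a = complex] show ?thesis
        by (simp add: \<tau>_def[abs_def])
    qed
    define D where "D n x = (F x (\<tau> n) - F x 0) / \<tau> n" for n x
    define D' where "D' n x = (deriv (\<lambda>x. F x (\<tau> n)) x - deriv (\<lambda>x. F x 0) x) / \<tau> n" for n x
    have ul: "uniform_limit (cball x0 e1) D G sequentially"
    proof (rule uniform_limitI)
      fix e :: real assume "e > 0"
      have "(\<lambda>n. C * cmod (\<tau> n)) \<longlonglongrightarrow> C * 0"
        by (intro tendsto_mult_left tendsto_norm_zero \<tau>0)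
      then have "eventually (\<lambda>n. C * cmod (\<tau> n) < e) sequentially"
        using \<open>e > 0\<close> by (auto dest: order_tendstoD(2))
      then show "\<forall>\<^sub>F n in sequentially. \<forall>x\<in>cball x0 e1. dist (D n x) (G x) < e"
      proof eventually_elim
        case (elim n)
        show ?case
          unfolding D_def dist_norm using le_less_trans[OF rate[OF _ \<tau>] elim] by blast
      qed
    qed
    have "\<exists>g'. \<forall>x\<in>ball x0 e1. (G has_field_derivative g' x) (at x) \<and> ((\<lambda>n. D' n x) \<longlonglongrightarrow> g' x)"
    proof (rule has_complex_derivative_uniform_sequence)
      fix n x assume x: "x \<in> ball x0 e1"
      have "(x, \<tau> n) \<in> W" "(x, 0) \<in> W"
        using sub x \<tau> e2 by auto
      then show "(D n has_field_derivative D' n x) (at x)"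
        unfolding D_def[abs_def] D'_def
        by (intro DERIV_cdivide DERIV_diff field_differentiable_derivI[OF diff1])
    next
      fix x assume "x \<in> ball x0 e1"
      then obtain d where d: "d > 0" "cball x d \<subseteq> ball x0 e1"
        by (meson open_ball open_contains_cball)
      then have "uniform_limit (cball x d) D G sequentially"
        by (intro uniform_limit_on_subset[OF ul]) (use ball_subset_cball in blast)
      with d show "\<exists>d>0. cball x d \<subseteq> ball x0 e1 \<and> uniform_limit (cball x d) D G sequentially"
        by blast
    qed simp
    then obtain d where d: "(G has_field_derivative d) (at x0)" "(\<lambda>n. D' n x0) \<longlonglongrightarrow> d"
      using centre_in_ball[of x0 e1] e1(1) by blast
    have "d = d'" if "((\<lambda>t. deriv (\<lambda>x. F x t) x0) has_field_derivative d') (at 0)" for d'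
    proof -
      \<comment> \<open>\<open>D' n x0\<close> is the difference quotient at 0, with step
        \<open>\<tau> n\<close>, of the partial derivative in the first variable, so the assumed
        derivative is its limit.\<close>
      have "filterlim \<tau> (at 0) sequentially"
        using \<tau>0 \<tau>(2) by (simp add: filterlim_at)
      with that have "(\<lambda>n. D' n x0) \<longlonglongrightarrow> d'"
        using filterlim_compose[OF that[unfolded has_field_derivative_iff]] by (simp add: D'_def)
      with d(2) show ?thesis
        by (rule LIMSEQ_unique)
    qed
    with d(1) show ?thesis
      by (intro exI[of _ d] conjI allI impI)
  qed
  show "\<And>x. (x, 0) \<in> W \<Longrightarrow> (\<lambda>x. deriv (F x) 0) field_differentiable (at x)"
    using main unfolding field_differentiable_def G_def[abs_def] by meson
  show "\<And>x d. (x, 0) \<in> W \<Longrightarrow> ((\<lambda>t. deriv (\<lambda>x. F x t) x) has_field_derivative d) (at 0)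
        \<Longrightarrow> deriv (\<lambda>x. deriv (F x) 0) x = d"
    using main DERIV_imp_deriv unfolding G_def[abs_def] by metis
qed

section \<open>Determinants\<close>

text \<open>This is the matrix determinant lemma. Perturbed rows are introduced one at a time; by
  multilinearity each new row \<open>k\<close> adds the determinant in which that row is
  \<open>x $ k *s y\<close>. The other perturbations can then be removed by row operations with row
  \<open>k\<close>, leaving \<open>x $ k * y $ k\<close>.\<close>

lemma det_identity_plus_rank_one:
  fixes x y :: "'a :: field ^ 'n"
  shows "det (\<chi> i. axis i 1 + x $ i *s y) = 1 + (\<Sum>i\<in>UNIV. x $ i * y $ i)"
proof -
  have unit: "row i (mat 1 :: 'a ^ 'n ^ 'n) = axis i 1" for i
    by (simp add: row_def mat_def axis_def vec_eq_iff)
  have replaced: "det (\<chi> i. if i = k then y else if i \<in> S then axis i 1 + x $ i *s y else axis i 1)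
      = y $ k" if "finite S" "k \<notin> S" for k S
    using that
  proof (induction S rule: finite_induct)
    case empty
    show ?case
      using cramer_lemma_transpose[of k y "mat 1 :: 'a ^ 'n ^ 'n"]
      unfolding unit basis_expansion by (simp cong: if_cong)
  next
    case (insert m S)
    let ?A = "(\<chi> i. if i = k then y else if i \<in> S then axis i 1 + x $ i *s y else axis i 1)
      :: 'a ^ 'n ^ 'n"
    have "m \<noteq> k"
      using insert.prems by blast
    then have "det ?A = det (\<chi> i. if i = m then row m ?A + x $ m *s row k ?A else row i ?A)"
      by (rule det_row_operation[symmetric])
    also have "(\<chi> i. if i = m then row m ?A + x $ m *s row k ?A else row i ?A) =
        (\<chi> i. if i = k then y else if i \<in> insert m S then axis i 1 + x $ i *s y else axis i 1)"
      using insert.hyps \<open>m \<noteq> k\<close> by (auto simp: vec_eq_iff row_def)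
    finally show ?case
      using insert by simp
  qed
  have "det (\<chi> i. if i \<in> S then axis i 1 + x $ i *s y else axis i 1)
      = 1 + (\<Sum>i\<in>S. x $ i * y $ i)" if "finite S" for S
    using that
  proof (induction S rule: finite_induct)
    case empty
    have "(\<chi> i. axis i 1) = (mat 1 :: 'a ^ 'n ^ 'n)"
      by (simp add: mat_def axis_def vec_eq_iff)
    then show ?case by simp
  next
    case (insert k S)
    let ?r = "\<lambda>i. if i \<in> S then axis i 1 + x $ i *s y else axis i 1"
    have "det (\<chi> i. if i \<in> insert k S then axis i 1 + x $ i *s y else axis i 1)
        = det (\<chi> i. if i = k then axis i 1 + x $ i *s y else ?r i)"
      by (rule arg_cong[where f = det]) (auto simp: vec_eq_iff)
    also have "\<dots> = det (\<chi> i. if i = k then axis i 1 else ?r i)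
        + det (\<chi> i. if i = k then x $ k *s y else ?r i)"
      by (subst det_row_add[symmetric]) (auto intro!: arg_cong[where f = det] simp: vec_eq_iff)
    also have "(\<chi> i. if i = k then axis i 1 else ?r i) = (\<chi> i. ?r i)"
      using insert.hyps by (auto simp: vec_eq_iff)
    also have "det (\<chi> i. if i = k then x $ k *s y else ?r i) = x $ k * y $ k"
      by (simp add: det_row_mul replaced insert.hyps)
    finally show ?case
      using insert by simp
  qed
  from this[of UNIV] show ?thesis by simp
qed

lemma matrix_vector_mult_axis: "((A :: 'a :: semiring_1 ^ 'n ^ 'm) *v axis j 1) $ i = A $ i $ j"
  by (simp add: matrix_vector_mult_def axis_def if_distrib cong: if_cong)

lemma mat_vector_mult: "mat s *v (v :: 'a :: semiring_1 ^ 'n) = s *s v"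
  by (simp add: vec_eq_iff matrix_vector_mult_def mat_def if_distrib[of "\<lambda>c. c * _"] cong: if_cong)

text \<open>The Leibniz sum has n! terms of modulus at most 1. Any bound depending only on the
  dimension would serve the power argument that follows.\<close>

lemma norm_det_le_fact:
  fixes A :: "complex ^ 'n ^ 'n"
  assumes "\<And>i j. cmod (A $ i $ j) \<le> 1"
  shows "cmod (det A) \<le> fact CARD('n)"
proof -
  have "cmod (det A) \<le> (\<Sum>p\<in>{p. p permutes (UNIV :: 'n set)}. 1)"
    unfolding det_def
  proof (rule sum_norm_le)
    fix p :: "'n \<Rightarrow> 'n"
    have "cmod (of_int (sign p)) = 1"
      by (simp add: sign_def)
    moreover have "cmod (\<Prod>i\<in>UNIV. A $ i $ p i) \<le> 1"
      unfolding prod_norm[symmetric] by (intro prod_le_1) (use assms in auto)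
    ultimately show "cmod (of_int (sign p) * (\<Prod>i\<in>UNIV. A $ i $ p i)) \<le> 1"
      by (simp add: norm_mult)
  qed
  then show ?thesis
    using card_permutations[of "UNIV :: 'n set", OF refl] by simp
qed

text \<open>The powers of a contraction have uniformly bounded entries, hence uniformly bounded determinants.\<close>

lemma norm_det_contraction_le_1:
  fixes A :: "complex ^ 'n ^ 'n"
  assumes A: "\<And>v. norm (A *v v) \<le> norm v"
  shows "cmod (det A) \<le> 1"
proof (rule ccontr)
  define P where "P k = (((**) A) ^^ k) (mat 1)" for k
  have P_contr: "norm (P k *v v) \<le> norm v" for k v
  proof (induction k)
    case (Suc k)
    have "norm (P (Suc k) *v v) = norm (A *v (P k *v v))"
      by (simp add: P_def matrix_vector_mul_assoc)
    also have "\<dots> \<le> norm v"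
      using A Suc by (rule order_trans)
    finally show ?case .
  qed (simp add: P_def)
  have "cmod (P k $ i $ j) \<le> 1" for k i j
  proof -
    have "cmod ((P k *v axis j 1) $ i) \<le> norm (axis j 1 :: complex ^ 'n)"
      using Finite_Cartesian_Product.norm_nth_le P_contr by (rule order_trans)
    moreover have "norm (axis j 1 :: complex ^ 'n) = 1"
      by (simp add: norm_eq_sqrt_inner inner_axis_axis)
    ultimately show ?thesis
      by (simp add: matrix_vector_mult_axis)
  qed
  then have "cmod (det (P k)) \<le> fact CARD('n)" for k
    by (rule norm_det_le_fact)
  moreover have "det (P k) = det A ^ k" for k
    by (induction k) (simp_all add: P_def det_mul)
  ultimately have "cmod (det A) ^ k \<le> fact CARD('n)" for k
    by (metis norm_power)
  moreover assume "\<not> cmod (det A) \<le> 1"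
  then obtain k where "fact CARD('n) < cmod (det A) ^ k"
    using real_arch_pow by (metis not_le)
  ultimately show False
    by (meson not_le)
qed

text \<open>The preimage \<open>h\<close> of the normal vector \<open>w\<close> need not be parallel
  to \<open>z\<close>. A rank-one perturbation \<open>C\<close> of the identity therefore fixes the
  complement of \<open>z\<close> and sends \<open>z\<close> to a multiple of \<open>h\<close>. Then
  \<open>A ** C\<close> respects the orthogonal splittings by \<open>z\<close> and \<open>w\<close>,
  and divided by \<open>sqrt l\<close> it is a contraction; dividing by \<open>det C\<close> gives
  the bound.\<close>

lemma norm_det_le_of_tangential_bound:
  fixes A :: "complex ^ 'n ^ 'n"
  assumes adj: "\<And>v. cinner (A *v v) w = of_real l * cinner v z"
    and tang: "\<And>v. cinner v z = 0 \<Longrightarrow> (norm (A *v v))\<^sup>2 \<le> l * (norm v)\<^sup>2"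
    and "l > 0" "z \<noteq> 0" "w \<noteq> 0" and h: "A *v h = w"
  shows "cmod (det A) \<le> norm z / norm w * l powr ((real CARD('n) + 1) / 2)"
proof -
  define r where "r = norm z"
  define R where "R = norm w"
  have r: "r > 0" and R: "R > 0"
    using assms by (auto simp: r_def R_def)
  have hz: "cinner h z = of_real (R\<^sup>2 / l)"
    using adj[of h] \<open>l > 0\<close> by (simp add: h cinner_self R_def divide_simps)
  \<comment> \<open>\<open>a\<close> makes \<open>(a * cinner v z) *s z\<close> the orthogonal
    projection of \<open>v\<close> onto the line of \<open>z\<close>. \<open>b\<close> is chosen so
    that \<open>b *s w\<close> has exactly \<open>sqrt l\<close> times the norm of
    \<open>a *s z\<close>.\<close>
  define a where "a = complex_of_real (1 / r\<^sup>2)"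
  define b where "b = complex_of_real (sqrt l / (r * R))"
  define x where "x = b *s h - a *s z"
  define C where "C = (\<chi> i. axis i 1 + x $ i *s (\<chi> j. cnj (z $ j)))"
  have C_apply: "C *v v = v + cinner v z *s x" for v
  proof -
    have "(C *v v) $ i = (\<Sum>j\<in>UNIV. (if i = j then v $ j else 0) + x $ i * (v $ j * cnj (z $ j)))" for i
      unfolding matrix_vector_mult_def C_def by (simp add: axis_def algebra_simps, intro sum.cong)
        (auto simp: algebra_simps)
    then have "(C *v v) $ i = v $ i + x $ i * cinner v z" for i
      by (simp add: sum.distrib cinner_def flip: sum_distrib_left)
    then show ?thesis
      by (simp add: vec_eq_iff mult.commute)
  qed
  have "det C = 1 + cinner x z"
    unfolding C_def det_identity_plus_rank_one by (simp add: cinner_def)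
  also have "\<dots> = of_real (1 + sqrt l / (r * R) * (R\<^sup>2 / l) - 1 / r\<^sup>2 * r\<^sup>2)"
    by (simp add: x_def cinner_diff_left cinner_scale_left hz a_def b_def cinner_self r_def)
  also have "1 + sqrt l / (r * R) * (R\<^sup>2 / l) - 1 / r\<^sup>2 * r\<^sup>2 = R / (r * sqrt l)"
    using r R \<open>l > 0\<close> by (simp add: field_simps power2_eq_square)
  finally have det_C: "det C = of_real (R / (r * sqrt l))" .
  define s where "s = complex_of_real (1 / sqrt l)"
  have contr: "norm ((mat s ** (A ** C)) *v v) \<le> norm v" for v
  proof -
    define t where "t = cinner v z"
    define d where "d = v - (a * t) *s z"
    have dz: "cinner d z = 0"
      using r by (simp add: d_def cinner_diff_left cinner_scale_left a_def t_def cinner_self r_def)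
    have "(A ** C) *v v = A *v d + (b * t) *s w"
      unfolding matrix_vector_mul_assoc[symmetric] C_apply d_def x_def t_def
      by (simp add: matrix_vector_right_distrib matrix_vector_mult_diff_distrib
          vector_scalar_commute vector_smult_assoc h)
        (simp add: vec_eq_iff algebra_simps)
    then have "(mat s ** (A ** C)) *v v = s *s (A *v d + (b * t) *s w)"
      by (simp only: matrix_vector_mul_assoc[symmetric, of "mat s"] mat_vector_mult)
    then have "norm ((mat s ** (A ** C)) *v v) = norm (A *v d + (b * t) *s w) / sqrt l"
      using \<open>l > 0\<close> by (simp only: norm_vector_scalar) (simp add: s_def norm_divide)
    moreover have "(norm (A *v d + (b * t) *s w))\<^sup>2 \<le> l * (norm v)\<^sup>2"
    proof -
      have "(norm (A *v d + (b * t) *s w))\<^sup>2 = (norm (A *v d))\<^sup>2 + (norm ((b * t) *s w))\<^sup>2"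
        \<comment> \<open>The mixed term vanishes: by \<open>adj\<close>, \<open>A\<close> sends
          vectors orthogonal to \<open>z\<close> to vectors orthogonal to \<open>w\<close>.\<close>
        by (simp add: power2_norm_add_cinner cinner_scale_right adj dz)
      also have "(norm ((b * t) *s w))\<^sup>2 = l * (norm ((a * t) *s z))\<^sup>2"
        using r R \<open>l > 0\<close>
        by (simp add: norm_vector_scalar norm_mult a_def b_def norm_divide power_mult_distrib
            power_divide flip: r_def R_def) (simp add: norm_mult field_simps power2_eq_square)
      also have "(norm (A *v d))\<^sup>2 + l * (norm ((a * t) *s z))\<^sup>2
          \<le> l * ((norm d)\<^sup>2 + (norm ((a * t) *s z))\<^sup>2)"
        using tang[OF dz] by (simp add: algebra_simps)
      also have "(norm d)\<^sup>2 + (norm ((a * t) *s z))\<^sup>2 = (norm v)\<^sup>2"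
        using power2_norm_add_cinner[of d "(a * t) *s z"] dz
        by (simp add: cinner_scale_right) (simp add: d_def)
      finally show ?thesis .
    qed
    then have "norm (A *v d + (b * t) *s w) \<le> sqrt l * norm v"
      using real_le_rsqrt real_sqrt_mult by (metis norm_ge_zero real_sqrt_abs real_sqrt_le_mono abs_of_nonneg)
    ultimately show ?thesis
      using \<open>l > 0\<close> by (simp add: divide_le_eq mult.commute)
  qed
  have "det (mat s :: complex ^ 'n ^ 'n) = s ^ CARD('n)"
    by (subst det_diagonal) (simp_all add: mat_def)
  with norm_det_contraction_le_1[OF contr]
  have "(1 / sqrt l) ^ CARD('n) * cmod (det A) * (R / (r * sqrt l)) \<le> 1"
    using r R \<open>l > 0\<close> by (simp add: det_mul det_C norm_mult norm_power s_def norm_divide)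
  then have "cmod (det A) \<le> r / R * (sqrt l ^ CARD('n) * sqrt l)"
    using r R \<open>l > 0\<close> by (simp add: field_simps)
  also have "sqrt l ^ CARD('n) * sqrt l = l powr ((real CARD('n) + 1) / 2)"
    using \<open>l > 0\<close> by (simp add: powr_half_sqrt[symmetric] powr_powr flip: powr_realpow powr_add)
      (simp add: field_simps)
  finally show ?thesis
    by (simp add: r_def R_def)
qed

section \<open>Extremal points on spheres\<close>

lemma radial_derivative_power2_norm:
  fixes F :: "complex ^ 'n \<Rightarrow> complex ^ 'm"
  assumes "(F has_derivative (\<lambda>h. A *v h)) (at p)"
  shows "((\<lambda>a. (norm (F (a *\<^sub>R p)))\<^sup>2) has_real_derivative 2 * Re (cinner (A *v p) (F p))) (at 1)"
proof -
  have "((\<lambda>a. a *\<^sub>R p) has_derivative (\<lambda>h. h *\<^sub>R p)) (at (1::real))"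
    by (auto intro!: derivative_eq_intros)
  then have "((\<lambda>a. F (a *\<^sub>R p)) has_derivative (\<lambda>h. A *v (h *\<^sub>R p))) (at (1::real))"
    by (rule has_derivative_compose) (use assms in simp)
  moreover have "A *v (h *\<^sub>R p) = h *\<^sub>R (A *v p)" for h :: real
    by (simp add: scaleR_eq_vector_scalar vector_scalar_commute)
  ultimately have "((\<lambda>a. F (a *\<^sub>R p)) has_derivative (\<lambda>h. h *\<^sub>R (A *v p))) (at (1::real))"
    by simp
  from has_derivative_inner[OF this this] show ?thesis
    by (simp add: power2_norm_eq_inner has_field_derivative_def Re_cinner
        inner_commute mult_commute_abs algebra_simps)
qed

text \<open>Lagrange multipliers: stationarity along great circles shows that every real tangent
  vector is sent to the real orthogonal complement of \<open>F p\<close>. This determines the real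
  part of the identity with a real factor; replacing \<open>v\<close> by a multiple with -i gives
  the imaginary part, with the same real factor.\<close>

lemma extremal_multiplier:
  fixes F :: "complex ^ 'n \<Rightarrow> complex ^ 'm"
  assumes deriv: "(F has_derivative (\<lambda>h. A *v h)) (at p)" and "p \<noteq> 0"
    and extremal: "(\<forall>q. norm q = norm p \<longrightarrow> norm (F q) \<le> norm (F p))
      \<or> (\<forall>q. norm q = norm p \<longrightarrow> norm (F p) \<le> norm (F q))"
  obtains l :: real where "\<And>v. cinner (A *v v) (F p) = of_real l * cinner v p"
proof -
  have scaleR: "A *v (r *\<^sub>R v) = r *\<^sub>R (A *v v)" for r v
    by (simp add: scaleR_eq_vector_scalar vector_scalar_commute)
  have tangent: "(A *v v) \<bullet> F p = 0" if "norm v = norm p" "v \<bullet> p = 0" for v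
  proof -
    \<comment> \<open>For \<open>v\<close> real orthogonal to \<open>p\<close> and of the same norm
      this is a great circle through \<open>p\<close> with velocity \<open>v\<close>.\<close>
    define c where "c t = cos t *\<^sub>R p + sin t *\<^sub>R v" for t
    have "(norm (c t))\<^sup>2 = (norm p)\<^sup>2" for t
    proof -
      have "(norm (c t))\<^sup>2 = (cos t)\<^sup>2 * (norm p)\<^sup>2 + (sin t)\<^sup>2 * (norm v)\<^sup>2"
        using that(2) unfolding power2_norm_eq_inner c_def
        by (simp add: inner_add inner_commute power2_eq_square algebra_simps)
      also have "\<dots> = (norm p)\<^sup>2"
        using that(1) by (simp flip: distrib_right)
      finally show ?thesis .
    qed
    then have c_sphere: "norm (c t) = norm p" for t
      by (simp add: power2_eq_iff_nonneg)
    have c0: "c 0 = p"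
      by (simp add: c_def)
    have "(c has_derivative (\<lambda>h. h *\<^sub>R v)) (at 0)"
      unfolding c_def[abs_def] by (auto intro!: derivative_eq_intros)
    then have "((\<lambda>t. F (c t)) has_derivative (\<lambda>h. h *\<^sub>R (A *v v))) (at 0)"
      using has_derivative_compose[of c "\<lambda>h. h *\<^sub>R v" 0 UNIV F "\<lambda>h. A *v h"] deriv
      by (simp add: c0 scaleR)
    from has_derivative_inner[OF this this]
    have "((\<lambda>t. F (c t) \<bullet> F (c t)) has_real_derivative 2 * ((A *v v) \<bullet> F p)) (at 0)"
      by (simp add: c0 has_field_derivative_def inner_commute mult_commute_abs algebra_simps)
    moreover have "(\<forall>t. F (c t) \<bullet> F (c t) \<le> F (c 0) \<bullet> F (c 0))
        \<or> (\<forall>t. F (c 0) \<bullet> F (c 0) \<le> F (c t) \<bullet> F (c t))"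
      using extremal c_sphere unfolding power2_norm_eq_inner[symmetric]
      by (simp add: c0 power_mono) (metis norm_ge_zero power_mono)
    ultimately have "2 * ((A *v v) \<bullet> F p) = 0"
      using DERIV_local_max[where d = 1] DERIV_local_min[where d = 1] zero_less_one by blast
    then show ?thesis by simp
  qed
  define l where "l = ((A *v p) \<bullet> F p) / (p \<bullet> p)"
  have real_part: "(A *v v) \<bullet> F p = l * (v \<bullet> p)" for v
  proof -
    define t where "t = (v \<bullet> p) / (p \<bullet> p)"
    define v' where "v' = v - t *\<^sub>R p"
    have v'p: "v' \<bullet> p = 0"
      using \<open>p \<noteq> 0\<close> by (simp add: v'_def t_def inner_diff_left)
    have "(A *v v') \<bullet> F p = 0"
    proof (cases "v' = 0")
      case False
      then have "(A *v ((norm p / norm v') *\<^sub>R v')) \<bullet> F p = 0"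
        using v'p by (intro tangent) auto
      then show ?thesis
        using False \<open>p \<noteq> 0\<close> by (simp add: scaleR)
    qed simp
    moreover have "A *v v = A *v v' + t *\<^sub>R (A *v p)"
      by (simp add: v'_def matrix_vector_mult_diff_distrib scaleR)
    ultimately show ?thesis
      by (simp add: inner_add_left t_def l_def)
  qed
  have "cinner (A *v v) (F p) = of_real l * cinner v p" for v
  proof -
    have Im: "Im (cinner x y) = Re (cinner ((- \<i>) *s x) y)" for x y :: "complex ^ 'k"
      by (simp only: cinner_scale_left) simp
    have "Re (cinner (A *v v) (F p)) = l * Re (cinner v p)" for v
      by (simp add: Re_cinner real_part)
    then show ?thesis
      unfolding complex_eq_iff Im vector_scalar_commute[symmetric] by (simp add: Im)
  qed
  then show thesis
    by (rule that)
qed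

text \<open>This is Parseval's inequality truncated to the first two Taylor coefficients. It is
  obtained from the maximum principle for one scalar function \<open>H\<close>, whose value at 0 is
  the left-hand side \<open>T\<close> and whose real part on the circle is at most the mean of
  \<open>M\<^sup>2\<close> and \<open>T\<close>.\<close>

lemma disc_coefficients_bound:
  fixes \<phi> :: "complex \<Rightarrow> complex ^ 'n"
  assumes S: "open S" "cball 0 s \<subseteq> S" and "0 < s"
    and diff: "\<And>\<zeta>. \<zeta> \<in> S \<Longrightarrow> \<exists>d. (\<phi> has_derivative (\<lambda>h. h *s d)) (at \<zeta>)"
    and diff0: "(\<phi> has_derivative (\<lambda>h. h *s c)) (at 0)"
    and M: "\<And>\<zeta>. cmod \<zeta> = s \<Longrightarrow> norm (\<phi> \<zeta>) \<le> M"
  shows "(norm (\<phi> 0))\<^sup>2 + s\<^sup>2 * (norm c)\<^sup>2 \<le> M\<^sup>2"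
proof -
  define T where "T = (norm (\<phi> 0))\<^sup>2 + s\<^sup>2 * (norm c)\<^sup>2"
  define k where "k \<zeta> = cinner (\<phi> \<zeta>) c" for \<zeta>
  have hol: "(\<lambda>\<zeta>. cinner (\<phi> \<zeta>) u) holomorphic_on S" for u
    using diff has_field_derivative_cinner_curve S(1)
    by (metis (no_types) holomorphic_on_open)
  define K where "K \<zeta> = (if \<zeta> = 0 then deriv k 0 else (k \<zeta> - k 0) / \<zeta>)" for \<zeta>
  have "0 \<in> interior S"
    using S \<open>0 < s\<close> by (auto simp: interior_open)
  from pole_lemma[OF hol[of c, folded k_def] this] have "K holomorphic_on S"
    by (simp add: K_def[abs_def] cong: if_cong)
  \<comment> \<open>The second summand is a holomorphic substitute for pairing with
    \<open>\<zeta> *s c\<close>: on the circle s^2/\<zeta> is the conjugate of \<zeta>, so up to a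
    constant pairing \<open>H\<close> becomes
    \<open>cinner (\<phi> \<zeta>) (\<phi> 0 + \<zeta> *s c)\<close>.\<close>
  define H where "H \<zeta> = cinner (\<phi> \<zeta>) (\<phi> 0) + of_real (s\<^sup>2) * K \<zeta>" for \<zeta>
  \<comment> \<open>The exponential turns a bound on real parts into one on moduli, as the maximum
    principle requires.\<close>
  have "(\<lambda>\<zeta>. exp (H \<zeta>)) holomorphic_on S"
    unfolding H_def by (intro holomorphic_intros hol \<open>K holomorphic_on S\<close>)
  moreover have "cmod (exp (H \<zeta>)) \<le> exp ((M\<^sup>2 + T) / 2)" if \<zeta>: "cmod \<zeta> = s" for \<zeta>
  proof -
    define y where "y = \<phi> 0 + \<zeta> *s c"
    have "\<zeta> \<noteq> 0"
      using \<zeta> \<open>0 < s\<close> by auto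
    have "of_real (s\<^sup>2) / \<zeta> = cnj \<zeta>"
      using \<open>\<zeta> \<noteq> 0\<close> by (simp add: \<zeta>[symmetric] complex_norm_square field_simps del: of_real_power)
    then have "of_real (s\<^sup>2) * K \<zeta> = cnj \<zeta> * (k \<zeta> - k 0)"
      using \<open>\<zeta> \<noteq> 0\<close> by (simp add: K_def field_simps)
    then have "H \<zeta> = cinner (\<phi> \<zeta>) y - cinner (\<phi> 0) (\<zeta> *s c)"
      by (simp add: H_def y_def cinner_add_right cinner_scale_right k_def algebra_simps)
    then have "Re (H \<zeta>) = \<phi> \<zeta> \<bullet> y - Re (cinner (\<phi> 0) (\<zeta> *s c))"
      by (simp add: Re_cinner)
    moreover have "(norm y)\<^sup>2 = T + 2 * Re (cinner (\<phi> 0) (\<zeta> *s c))"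
      by (simp add: y_def power2_norm_add_cinner T_def norm_vector_scalar \<zeta> power_mult_distrib)
    moreover have "2 * (\<phi> \<zeta> \<bullet> y) \<le> (norm (\<phi> \<zeta>))\<^sup>2 + (norm y)\<^sup>2"
      using inner_ge_zero[of "\<phi> \<zeta> - y"]
      by (simp add: power2_norm_eq_inner inner_diff inner_commute algebra_simps)
    moreover have "(norm (\<phi> \<zeta>))\<^sup>2 \<le> M\<^sup>2"
      using M[OF \<zeta>] by (simp add: power_mono)
    ultimately show ?thesis
      by simp
  qed
  ultimately have "cmod (exp (H 0)) \<le> exp ((M\<^sup>2 + T) / 2)"
    using norm_le_on_disc_of_norm_le_on_sphere[OF _ S \<open>0 < s\<close>] \<open>0 < s\<close>
    by (metis norm_zero less_eq_real_def)
  moreover have "H 0 = of_real T"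
    using DERIV_imp_deriv[OF has_field_derivative_cinner_curve[OF diff0, of c]]
    by (simp add: H_def K_def k_def[abs_def] cinner_self T_def)
  ultimately show ?thesis
    by (simp add: T_def)
qed

text \<open>Only continuity along the complex line through \<open>p\<close> is needed for the limit
  to the sphere. There \<open>J d\<close> is the derivative at t = 0 of F(xp + td), componentwise a
  partial derivative of a function of two complex variables, hence itself holomorphic in x.\<close>

lemma isCont_directional_derivative:
  fixes F :: "complex ^ 'n \<Rightarrow> complex ^ 'm"
  assumes U: "open U" and F: "holomorphic_map_on F U" and "p \<in> U"
  shows "isCont (\<lambda>x::complex. complex_jacobian F (x *s p) *v d) 1"
proof -
  define W where "W = {(x, t). x *s p + t *s d \<in> U}"
  have cont: "continuous_on UNIV (\<lambda>y :: complex \<times> complex. fst y *s p + snd y *s d)"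
    unfolding vector_scalar_mult_def by (intro continuous_intros continuous_on_vec_lambda)
  have W: "open W"
    using open_vimage[OF U cont] by (simp add: W_def vimage_def case_prod_unfold)
  have contF: "continuous_on W (\<lambda>(x, t). F (x *s p + t *s d))"
    unfolding case_prod_unfold
    by (rule continuous_on_compose2[OF holomorphic_map_on_imp_continuous_on[OF F]
          continuous_on_subset[OF cont]]) (auto simp: W_def)
  have slice: "((\<lambda>\<zeta>. F (b + \<zeta> *s v) $ i) has_field_derivative
      (complex_jacobian F (b + \<zeta> *s v) *v v) $ i) (at \<zeta>)" if "b + \<zeta> *s v \<in> U" for b v i \<zeta>
    using bounded_linear.has_derivative[OF bounded_linear_vec_nth
        has_derivative_holomorphic_curve[OF has_derivative_line
          has_derivative_complex_jacobian[OF F that]], of i]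
    by (simp add: has_field_derivative_def mult_commute_abs)
  have "isCont (\<lambda>x. (complex_jacobian F (x *s p) *v d) $ i) 1" for i
  proof -
    define g where "g x t = F (x *s p + t *s d) $ i" for x t
    have "(\<lambda>x. deriv (g x) 0) field_differentiable (at 1)"
    proof (rule partial_deriv_field_differentiable[OF W])
      show "continuous_on W (\<lambda>(x, t). g x t)"
        using continuous_on_component[OF contF, of i] by (simp add: g_def case_prod_unfold)
      show "(1, 0) \<in> W"
        using \<open>p \<in> U\<close> by (simp add: W_def)
      fix x t assume "(x, t) \<in> W"
      then have *: "x *s p + t *s d \<in> U" "t *s d + x *s p \<in> U"
        by (simp_all add: W_def add.commute)
      show "g x field_differentiable (at t)"
        using slice[OF *(1)] unfolding g_def[abs_def] field_differentiable_def by blast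
      show "(\<lambda>x. g x t) field_differentiable (at x)"
        using slice[OF *(2)] unfolding g_def add.commute[of _ "t *s d"] field_differentiable_def
        by blast
    qed
    then have cont_deriv: "isCont (\<lambda>x. deriv (g x) 0) 1"
      by (rule field_differentiable_imp_continuous_at)
    have "\<forall>\<^sub>F x in nhds 1. deriv (g x) 0 = (complex_jacobian F (x *s p) *v d) $ i"
    proof -
      have "continuous_on UNIV (\<lambda>x :: complex. x *s p)"
        unfolding vector_scalar_mult_def by (intro continuous_intros continuous_on_vec_lambda)
      then have "open ((\<lambda>x :: complex. x *s p) -` U)"
        using U by (rule open_vimage[rotated])
      then have "\<forall>\<^sub>F x in nhds 1. x \<in> (\<lambda>x :: complex. x *s p) -` U"
        using \<open>p \<in> U\<close> by (intro eventually_nhds_in_open) auto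
      then show ?thesis
      proof eventually_elim
        case (elim x)
        then show ?case
          using slice[of "x *s p" 0 d i] unfolding g_def[abs_def] by (simp add: DERIV_imp_deriv)
      qed
    qed
    from isCont_cong[OF this] cont_deriv show ?thesis
      by blast
  qed
  then show ?thesis
    unfolding isCont_def by (intro vec_tendstoI)
qed

text \<open>Scaling the disc \<open>\<zeta> \<mapsto> p + \<zeta> d\<close> by \<open>a < 1\<close> puts its boundary on the sphere through \<open>p\<close>;
  letting \<open>a \<rightarrow> 1\<close> yields the second-order condition without second derivatives of \<open>F\<close>.\<close>

lemma tangential_derivative_bound:
  fixes F :: "complex ^ 'n \<Rightarrow> complex ^ 'm"
  assumes U: "open U" "cball 0 (norm p) \<subseteq> U" and F: "holomorphic_map_on F U" and "p \<noteq> 0"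
    and max: "\<And>q. norm q = norm p \<Longrightarrow> norm (F q) \<le> norm (F p)"
    and adj: "\<And>v. cinner (complex_jacobian F p *v v) (F p) = of_real l * cinner v p"
    and tang: "cinner d p = 0"
  shows "(norm (complex_jacobian F p *v d))\<^sup>2 \<le> l * (norm d)\<^sup>2"
proof (cases "d = 0")
  case False
  define R where "R = norm p"
  have "R > 0"
    using \<open>p \<noteq> 0\<close> by (simp add: R_def)
  have "p \<in> U"
    using U(2) by auto
  define D where "D a = (norm (F (complex_of_real a *s p)))\<^sup>2" for a
  define E where "E a = (norm (complex_jacobian F (complex_of_real a *s p) *v d))\<^sup>2" for a
  have ineq: "R\<^sup>2 * (1 + a) * E a \<le> (norm d)\<^sup>2 * ((D a - D 1) / (a - 1))" if a: "0 < a" "a < 1" for a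
  proof -
    \<comment> \<open>Since \<open>d\<close> is orthogonal to \<open>p\<close>, the points of the
      scaled disc have squared norm a^2(R^2 + |\<zeta>|^2 |d|^2). This \<open>s\<close> is the
      radius at which that equals R^2.\<close>
    define s where "s = R * sqrt (1 / a\<^sup>2 - 1) / norm d"
    have "a\<^sup>2 < 1"
      using a by (simp add: power_less_one_iff)
    then have s2: "s\<^sup>2 * a\<^sup>2 * (norm d)\<^sup>2 = R\<^sup>2 * (1 - a\<^sup>2)" and "s > 0"
      using a False \<open>R > 0\<close> by (simp_all add: s_def power_mult_distrib power_divide field_simps)
    define \<phi> where "\<phi> \<zeta> = F (complex_of_real a *s p + \<zeta> *s (complex_of_real a *s d))" for \<zeta>
    define S where "S = (\<lambda>\<zeta>. complex_of_real a *s p + \<zeta> *s (complex_of_real a *s d)) -` U"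
    have norm_disc: "(norm (complex_of_real a *s p + \<zeta> *s (complex_of_real a *s d)))\<^sup>2
        = a\<^sup>2 * (R\<^sup>2 + (cmod \<zeta>)\<^sup>2 * (norm d)\<^sup>2)" for \<zeta>
      using tang cinner_commute[of p d]
      by (simp add: power2_norm_add_cinner norm_vector_scalar cinner_scale_left cinner_scale_right
          power_mult_distrib norm_mult R_def algebra_simps)
    have on_sphere: "a\<^sup>2 * (R\<^sup>2 + s\<^sup>2 * (norm d)\<^sup>2) = R\<^sup>2"
      using s2 by (simp add: algebra_simps)
    have curve: "(\<phi> has_derivative (\<lambda>h. h *s (complex_jacobian F
          (complex_of_real a *s p + \<zeta> *s (complex_of_real a *s d)) *v (complex_of_real a *s d)))) (at \<zeta>)"
      if "\<zeta> \<in> S" for \<zeta>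
      unfolding \<phi>_def[abs_def]
      by (rule has_derivative_holomorphic_curve[OF has_derivative_line
            has_derivative_complex_jacobian[OF F]]) (use that in \<open>simp add: S_def\<close>)
    have "open S"
      unfolding S_def
    proof (rule open_vimage[OF U(1)])
      show "continuous_on UNIV (\<lambda>\<zeta>. complex_of_real a *s p + \<zeta> *s (complex_of_real a *s d))"
        using has_derivative_continuous[OF has_derivative_line]
        by (blast intro: continuous_at_imp_continuous_on)
    qed
    moreover have sub: "cball 0 s \<subseteq> S"
    proof
      fix \<zeta> :: complex assume "\<zeta> \<in> cball 0 s"
      then have "(cmod \<zeta>)\<^sup>2 \<le> s\<^sup>2"
        by (simp add: power_mono)
      then have "a\<^sup>2 * (R\<^sup>2 + (cmod \<zeta>)\<^sup>2 * (norm d)\<^sup>2) \<le> a\<^sup>2 * (R\<^sup>2 + s\<^sup>2 * (norm d)\<^sup>2)"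
        by (intro mult_left_mono add_left_mono mult_right_mono) auto
      then have "norm (complex_of_real a *s p + \<zeta> *s (complex_of_real a *s d)) \<le> R"
        unfolding on_sphere norm_disc[symmetric] using \<open>R > 0\<close> by (simp add: power2_le_iff_abs_le)
      then show "\<zeta> \<in> S"
        using U(2) by (auto simp: S_def R_def)
    qed
    moreover have "norm (\<phi> \<zeta>) \<le> norm (F p)" if "cmod \<zeta> = s" for \<zeta>
    proof -
      have "(norm (complex_of_real a *s p + \<zeta> *s (complex_of_real a *s d)))\<^sup>2 = R\<^sup>2"
        using norm_disc that on_sphere by simp
      then show ?thesis
        unfolding \<phi>_def using \<open>R > 0\<close> by (intro max) (simp add: R_def power2_eq_iff_nonneg)
    qed
    ultimately have "(norm (\<phi> 0))\<^sup>2 + s\<^sup>2 * (norm (complex_jacobian F (complex_of_real a *s p)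
        *v (complex_of_real a *s d)))\<^sup>2 \<le> (norm (F p))\<^sup>2"
      using disc_coefficients_bound[of S s \<phi>] curve curve[of 0] \<open>s > 0\<close> by (simp add: subset_iff) blast
    then have "D a + s\<^sup>2 * a\<^sup>2 * E a \<le> D 1"
      by (simp add: D_def E_def \<phi>_def vector_scalar_commute norm_vector_scalar power_mult_distrib)
    then have "(norm d)\<^sup>2 * (s\<^sup>2 * a\<^sup>2 * E a) \<le> (norm d)\<^sup>2 * (D 1 - D a)"
      by (intro mult_left_mono) auto
    moreover have "(norm d)\<^sup>2 * (s\<^sup>2 * a\<^sup>2 * E a) = R\<^sup>2 * (1 + a) * E a * (1 - a)"
      using arg_cong[OF s2, of "\<lambda>x. x * E a"] by (simp add: algebra_simps power2_eq_square)
    \<comment> \<open>Division by \<open>1 - a > 0\<close> turns the increment of \<open>D\<close>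
      into its difference quotient at 1; the factor \<open>1 - a\<^sup>2\<close> on the other side
      leaves \<open>1 + a\<close>.\<close>
    ultimately show ?thesis
      using a by (simp add: field_simps)
  qed
  have "(D has_real_derivative 2 * Re (cinner (complex_jacobian F p *v p) (F p))) (at 1)"
    using radial_derivative_power2_norm[OF has_derivative_complex_jacobian[OF F \<open>p \<in> U\<close>]]
    by (simp add: D_def[abs_def] flip: scaleR_eq_vector_scalar)
  \<comment> \<open>The radial derivative is computed by \<open>adj\<close> with
    \<open>v = p\<close>, which is where the multiplier \<open>l\<close> enters the tangential
    bound.\<close>
  then have "((\<lambda>a. (D a - D 1) / (a - 1)) \<longlongrightarrow> 2 * (l * R\<^sup>2)) (at 1)"
    by (simp add: has_field_derivative_iff adj cinner_self R_def)
  then have "((\<lambda>a. (norm d)\<^sup>2 * ((D a - D 1) / (a - 1))) \<longlongrightarrow> (norm d)\<^sup>2 * (2 * (l * R\<^sup>2))) (at_left 1)"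
    by (intro tendsto_mult_left) (rule filterlim_at_split[THEN iffD1, THEN conjunct1])
  moreover have "((\<lambda>a. R\<^sup>2 * (1 + a) * E a) \<longlongrightarrow> R\<^sup>2 * (1 + 1) * E 1) (at_left 1)"
  proof (intro tendsto_mult tendsto_add tendsto_const tendsto_ident_at)
    have "isCont (\<lambda>a. complex_jacobian F (complex_of_real a *s p) *v d) 1"
      using isCont_o2[of 1 complex_of_real "\<lambda>x. complex_jacobian F (x *s p) *v d"]
        isCont_directional_derivative[OF U(1) F \<open>p \<in> U\<close>, of d] by simp
    then have "isCont E 1"
      unfolding E_def by (intro continuous_intros)
    then show "(E \<longlongrightarrow> E 1) (at_left 1)"
      by (simp add: isCont_def filterlim_at_split)
  qed
  moreover have "\<forall>\<^sub>F a in at_left 1. R\<^sup>2 * (1 + a) * E a \<le> (norm d)\<^sup>2 * ((D a - D 1) / (a - 1))"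
    using eventually_at_left_real[of 0 1] ineq by (auto elim: eventually_mono)
  ultimately have "R\<^sup>2 * (1 + 1) * E 1 \<le> (norm d)\<^sup>2 * (2 * (l * R\<^sup>2))"
    by (intro tendsto_le) auto
  then have "E 1 \<le> (norm d)\<^sup>2 * l"
    using \<open>R > 0\<close> by simp
  then show ?thesis
    by (simp add: E_def mult.commute)
qed simp

text \<open>A connectedness argument: the image of the sphere avoids the open ball of radius
  \<open>m\<close>, so that ball is split by two disjoint open sets, the image of the open ball and
  the complement of the image of the closed ball. It contains 0 = f(0), so it lies in the image;
  taking closures adds the boundary.\<close>

lemma ball_subset_image:
  fixes f :: "'a :: euclidean_space \<Rightarrow> 'b :: euclidean_space"
  assumes cont: "continuous_on (cball 0 r) f" and "open (f ` ball 0 r)"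
    and f0: "f 0 = 0" and "r > 0" "m > 0" and sphere: "\<And>\<xi>. norm \<xi> = r \<Longrightarrow> m \<le> norm (f \<xi>)"
  shows "cball 0 m \<subseteq> f ` cball 0 r"
proof -
  have closed: "closed (f ` cball 0 r)"
    using compact_continuous_image[OF cont] by (simp add: compact_imp_closed)
  have "f ` ball 0 r \<inter> ball 0 m = {} \<or> (- f ` cball 0 r) \<inter> ball 0 m = {}"
  proof (rule connectedD[OF connected_ball])
    show "ball 0 m \<subseteq> f ` ball 0 r \<union> - f ` cball 0 r"
    proof
      fix y :: 'b assume y: "y \<in> ball 0 m"
      show "y \<in> f ` ball 0 r \<union> - f ` cball 0 r"
      proof (cases "y \<in> f ` cball 0 r")
        case True
        then obtain x where "norm x \<le> r" "y = f x" by auto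
        moreover from this have "norm x \<noteq> r"
          using sphere[of x] y by auto
        ultimately show ?thesis by auto
      qed simp
    qed
  qed (use assms closed in auto)
  moreover have "0 \<in> ball 0 m \<inter> f ` ball 0 r"
    using f0 \<open>r > 0\<close> \<open>m > 0\<close> by (auto intro!: rev_image_eqI[of 0])
  ultimately have "ball 0 m \<subseteq> f ` cball 0 r"
    by blast
  from closure_mono[OF this] show ?thesis
    using \<open>m > 0\<close> closed by simp
qed

section \<open>Starlike mappings\<close>

lemma jacobian_inverse_mult:
  assumes f: "biholomorphic_map_on f S" and "open S" "z \<in> S"
  shows "complex_jacobian (inv_into S f) (f z) ** complex_jacobian f z = mat 1"
proof -
  let ?G = "complex_jacobian (inv_into S f) (f z)" and ?J = "complex_jacobian f z"
  have "(f has_derivative (\<lambda>h. ?J *v h)) (at z)"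
    using f \<open>z \<in> S\<close> by (auto simp: biholomorphic_map_on_def intro: has_derivative_complex_jacobian)
  moreover have "(inv_into S f has_derivative (\<lambda>h. ?G *v h)) (at (f z))"
    using f \<open>z \<in> S\<close> by (auto simp: biholomorphic_map_on_def intro: has_derivative_complex_jacobian)
  ultimately have "((\<lambda>x. inv_into S f (f x)) has_derivative (\<lambda>h. ?G *v (?J *v h))) (at z)"
    by (rule has_derivative_compose)
  then have "((\<lambda>x. x) has_derivative (\<lambda>h. ?G *v (?J *v h))) (at z)"
    by (rule has_derivative_transform_within_open[OF _ \<open>open S\<close> \<open>z \<in> S\<close>])
      (use f in \<open>simp add: biholomorphic_map_on_def\<close>)
  from has_derivative_unique[OF this has_derivative_ident]
  have "(?G ** ?J) *v h = mat 1 *v h" for h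
    by (metis matrix_vector_mul_assoc matrix_vector_mul_lid)
  then show ?thesis
    by (metis matrix_eq)
qed

lemma matrix_inv_jacobian:
  assumes "biholomorphic_map_on f S" "open S" "z \<in> S"
  shows "matrix_inv (complex_jacobian f z) = complex_jacobian (inv_into S f) (f z)"
proof -
  note GJ = jacobian_inverse_mult[OF assms]
  then have JG: "complex_jacobian f z ** complex_jacobian (inv_into S f) (f z) = mat 1"
    by (simp add: matrix_left_right_inverse)
  from GJ JG have "matrix_inv (complex_jacobian f z) ** complex_jacobian f z = mat 1"
    unfolding matrix_inv_def
    by (intro someI2[where Q = "\<lambda>M. M ** complex_jacobian f z = mat 1"]) auto
  with JG show ?thesis
    by (metis matrix_mul_assoc matrix_mul_lid matrix_mul_rid)
qed

text \<open>The map \<omega> -> (1-\<omega>)/(1+c\<omega>) is its own inverse. Composing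
  \<open>p\<close> with it gives a self-map \<open>g\<close> of the disc with
  \<open>g 0 = 0\<close>, to which the Schwarz lemma applies. In the application c =
  1-2\<gamma>.\<close>

lemma moebius_schwarz:
  fixes p :: "complex \<Rightarrow> complex" and c :: real
  assumes hol: "p holomorphic_on ball 0 1" and "p 0 = 1" and "\<bar>c\<bar> < 1"
    and range: "\<And>\<zeta>. cmod \<zeta> < 1 \<Longrightarrow> \<exists>\<omega>. cmod \<omega> < 1 \<and> p \<zeta> = (1 - \<omega>) / (1 + of_real c * \<omega>)"
    and "cmod \<zeta> < 1"
  shows "\<exists>\<omega>. cmod \<omega> \<le> cmod \<zeta> \<and> p \<zeta> * (1 + of_real c * \<omega>) = 1 - \<omega>"
proof -
  define g where "g \<zeta> = (1 - p \<zeta>) / (1 + of_real c * p \<zeta>)" for \<zeta>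
  have g: "1 + of_real c * p \<zeta> \<noteq> 0 \<and> cmod (g \<zeta>) < 1 \<and> p \<zeta> * (1 + of_real c * g \<zeta>) = 1 - g \<zeta>"
    if "cmod \<zeta> < 1" for \<zeta>
  proof -
    obtain \<omega> where \<omega>: "cmod \<omega> < 1" "p \<zeta> = (1 - \<omega>) / (1 + of_real c * \<omega>)"
      using range \<open>cmod \<zeta> < 1\<close> by blast
    have "cmod (of_real c * \<omega>) < 1"
      using \<open>\<bar>c\<bar> < 1\<close> \<omega>(1) mult_strict_mono'[of "\<bar>c\<bar>" 1 "cmod \<omega>" 1] by (simp add: norm_mult)
    then have nz: "1 + of_real c * \<omega> \<noteq> 0"
      by (metis add_eq_0_iff norm_minus_cancel norm_one less_irrefl)
    have c1: "1 + complex_of_real c \<noteq> 0"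
      using \<open>\<bar>c\<bar> < 1\<close> by (simp add: complex_eq_iff)
    have "1 + of_real c * p \<zeta> = (1 + of_real c) / (1 + of_real c * \<omega>)"
      using nz by (simp add: \<omega>(2) field_simps)
    moreover have "1 - p \<zeta> = \<omega> * (1 + of_real c) / (1 + of_real c * \<omega>)"
      using nz by (simp add: \<omega>(2) field_simps)
    ultimately have "1 + of_real c * p \<zeta> \<noteq> 0" "g \<zeta> = \<omega>"
      using nz c1 by (simp_all add: g_def)
    then show ?thesis
      using \<omega> nz by simp
  qed
  have "cmod (g \<zeta>) \<le> cmod \<zeta>"
  proof (rule Schwarz_Lemma(1)[OF _ _ _ \<open>cmod \<zeta> < 1\<close>])
    show "g holomorphic_on ball 0 1"
      unfolding g_def using g by (intro holomorphic_intros hol) auto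
  qed (use g \<open>p 0 = 1\<close> in \<open>auto simp: g_def\<close>)
  with g[OF \<open>cmod \<zeta> < 1\<close>] show ?thesis by blast
qed

text \<open>Writing \<open>J_f(z)\<^sup>-\<^sup>1 f(z)\<close> as the derivative of \<open>t \<mapsto> f\<^sup>-\<^sup>1((1 + t) f(z))\<close> at \<open>0\<close> makes it
  holomorphic along complex lines without knowing that the Jacobian is.\<close>

lemma starlike_radial_schwarz:
  fixes f :: "complex ^ 'n \<Rightarrow> complex ^ 'n"
  assumes \<gamma>: "0 < \<gamma>" "\<gamma> < 1" and f: "starlike_of_order \<gamma> f"
    and z: "z \<in> ball 0 1 - {0}"
  shows "\<exists>\<omega>. cmod \<omega> \<le> norm z \<and>
    cinner (matrix_inv (complex_jacobian f z) *v f z) z / of_real ((norm z)\<^sup>2)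
      * (1 + of_real (1 - 2 * \<gamma>) * \<omega>) = 1 - \<omega>"
proof -
  define B where "B = ball (0 :: complex ^ 'n) 1"
  define g where "g = inv_into B f"
  have bih: "biholomorphic_map_on f B" and f0: "f 0 = 0" and J0: "complex_jacobian f 0 = mat 1"
    and range: "\<And>z. z \<in> B \<Longrightarrow> z \<noteq> 0 \<Longrightarrow>
      1 / (of_real (norm z))\<^sup>2 * cinner (matrix_inv (complex_jacobian f z) *v f z) z
        \<in> (\<lambda>\<zeta>::complex. (1 - \<zeta>) / (1 + (1 - 2 * of_real \<gamma>) * \<zeta>)) ` ball 0 1"
    using f by (auto simp: starlike_of_order_def normalized_map_def B_def)
  have holf: "holomorphic_map_on f B" and inj: "inj_on f B" and opn: "open (f ` B)"
    and holg: "holomorphic_map_on g (f ` B)"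
    using bih by (auto simp: biholomorphic_map_on_def g_def)
  have "open B" "0 \<in> B"
    by (auto simp: B_def)
  have g_f: "g (f x) = x" if "x \<in> B" for x
    using inj that by (simp add: g_def)
  note inv_jac = matrix_inv_jacobian[OF bih \<open>open B\<close>, folded g_def]
  define u where "u = (1 / complex_of_real (norm z)) *s z"
  have "norm u = 1" and z_u: "z = complex_of_real (norm z) *s u"
    using z by (simp_all add: u_def norm_vector_scalar norm_divide vector_smult_assoc)
  have line: "\<zeta> *s u \<in> B \<longleftrightarrow> cmod \<zeta> < 1" for \<zeta>
    by (simp add: B_def norm_vector_scalar \<open>norm u = 1\<close>)
  \<comment> \<open>Two complex parameters: \<zeta> moves along the line through \<open>z\<close>,
    and t dilates the image point. The t-derivative of \<open>F\<close> at t = 0 is the quantity in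
    the starlikeness condition, paired with \<open>u\<close>.\<close>
  define \<Phi> where "\<Phi> y = (1 + snd y) *s f (fst y *s u)" for y :: "complex \<times> complex"
  define F where "F \<zeta> t = cinner (g (\<Phi> (\<zeta>, t))) u" for \<zeta> t
  define W where "W = (ball 0 1 \<times> UNIV) \<inter> \<Phi> -` (f ` B)"
  have cont_line: "continuous_on UNIV (\<lambda>\<zeta>::complex. \<zeta> *s u)"
    unfolding vector_scalar_mult_def by (intro continuous_intros continuous_on_vec_lambda)
  have cont_fline: "continuous_on (ball 0 1) (\<lambda>\<zeta>. f (\<zeta> *s u))"
    by (rule continuous_on_compose2[OF holomorphic_map_on_imp_continuous_on[OF holf]
          continuous_on_subset[OF cont_line]]) (auto simp: line)
  have "continuous_on (ball 0 1 \<times> UNIV) (\<lambda>y. f (fst y *s u))"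
    by (rule continuous_on_compose2[OF cont_fline]) (auto intro!: continuous_intros)
  then have cont\<Phi>: "continuous_on (ball 0 1 \<times> UNIV) \<Phi>"
    unfolding \<Phi>_def[abs_def] vector_scalar_mult_def
    by (intro continuous_intros continuous_on_vec_lambda continuous_on_component)
  have W: "open W"
    unfolding W_def using cont\<Phi> opn by (intro continuous_open_preimage open_Times) auto
  have "continuous_on W (\<lambda>y. g (\<Phi> y))"
    by (rule continuous_on_compose2[OF holomorphic_map_on_imp_continuous_on[OF holg]
          continuous_on_subset[OF cont\<Phi>]]) (auto simp: W_def)
  then have contF: "continuous_on W (\<lambda>(\<zeta>, t). F \<zeta> t)"
    unfolding F_def case_prod_unfold prod.collapse
    by (rule linear_continuous_on_compose[OF _ bounded_linear.linear[OF bounded_linear_cinner_left]])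
  have W0: "(\<zeta>, 0) \<in> W" if "cmod \<zeta> < 1" for \<zeta>
    using that line by (auto simp: W_def \<Phi>_def)
  have dt: "(F \<zeta> has_field_derivative
      cinner (complex_jacobian g (\<Phi> (\<zeta>, t)) *v f (\<zeta> *s u)) u) (at t)" if "(\<zeta>, t) \<in> W" for \<zeta> t
  proof -
    have "((\<lambda>t. f (\<zeta> *s u) + t *s f (\<zeta> *s u)) has_derivative (\<lambda>h. h *s f (\<zeta> *s u))) (at t)"
      by (rule has_derivative_line)
    then have "((\<lambda>t. \<Phi> (\<zeta>, t)) has_derivative (\<lambda>h. h *s f (\<zeta> *s u))) (at t)"
      by (simp add: \<Phi>_def vector_sadd_rdistrib)
    from has_field_derivative_cinner_curve[OF has_derivative_holomorphic_curve[OF this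
          has_derivative_complex_jacobian[OF holg]]] that
    show ?thesis
      unfolding F_def[abs_def] by (auto simp: W_def)
  qed
  have d\<zeta>: "((\<lambda>\<zeta>. F \<zeta> t) has_field_derivative cinner (complex_jacobian g (\<Phi> (\<zeta>, t))
      *v ((1 + t) *s (complex_jacobian f (\<zeta> *s u) *v u))) u) (at \<zeta>)" if "(\<zeta>, t) \<in> W" for \<zeta> t
  proof -
    have "cmod \<zeta> < 1"
      using that by (simp add: W_def)
    have "((\<lambda>\<zeta>. 0 + \<zeta> *s u) has_derivative (\<lambda>h. h *s u)) (at \<zeta>)"
      by (rule has_derivative_line)
    then have "((\<lambda>\<zeta>. f (0 + \<zeta> *s u)) has_derivative
        (\<lambda>h. h *s (complex_jacobian f (0 + \<zeta> *s u) *v u))) (at \<zeta>)"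
      by (rule has_derivative_holomorphic_curve[OF _ has_derivative_complex_jacobian[OF holf]])
        (simp add: line \<open>cmod \<zeta> < 1\<close>)
    then have "((\<lambda>\<zeta>. f (\<zeta> *s u)) has_derivative
        (\<lambda>h. h *s (complex_jacobian f (\<zeta> *s u) *v u))) (at \<zeta>)"
      by simp
    \<comment> \<open>Multiplication by \<open>1 + t\<close> is written as the matrix
      \<open>mat (1 + t)\<close> so that the chain rule for curves applies.\<close>
    from has_derivative_holomorphic_curve[OF this, of "\<lambda>v. (1 + t) *s v" "mat (1 + t)"]
    have "((\<lambda>\<zeta>. \<Phi> (\<zeta>, t)) has_derivative
        (\<lambda>h. h *s ((1 + t) *s (complex_jacobian f (\<zeta> *s u) *v u)))) (at \<zeta>)"
      using linear_imp_has_derivative[OF matrix_vector_mul_linear[of "mat (1 + t) :: complex ^ 'n ^ 'n"]]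
      by (simp add: \<Phi>_def mat_vector_mult)
    from has_field_derivative_cinner_curve[OF has_derivative_holomorphic_curve[OF this
          has_derivative_complex_jacobian[OF holg]]] that
    show ?thesis
      unfolding F_def[abs_def] by (auto simp: W_def)
  qed
  define q where "q \<zeta> = deriv (F \<zeta>) 0" for \<zeta>
  have q: "q \<zeta> = cinner (matrix_inv (complex_jacobian f (\<zeta> *s u)) *v f (\<zeta> *s u)) u"
    if "cmod \<zeta> < 1" for \<zeta>
    using DERIV_imp_deriv[OF dt[OF W0[OF that]]] inv_jac[of "\<zeta> *s u"] line that
    by (simp add: q_def \<Phi>_def)
  have "q field_differentiable (at \<zeta>)" if "cmod \<zeta> < 1" for \<zeta>
    unfolding q_def[abs_def]
    by (rule partial_deriv_field_differentiable[OF W contF _ _ W0[OF that]])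
      (use dt d\<zeta> field_differentiable_def in blast)+
  then have holq: "q holomorphic_on ball 0 1"
    by (auto simp: holomorphic_on_def field_differentiable_at_within)
  have "deriv q 0 = 1"
    unfolding q_def[abs_def]
  \<comment> \<open>At \<zeta> = 0 the other order of differentiation is explicit:
    \<open>\<Phi>\<close> vanishes there for every t and both Jacobians are the identity, so the
    \<zeta>-derivative is \<open>1 + t\<close>, whose t-derivative is 1.\<close>
  proof (rule deriv_partial_deriv_swap[OF W contF])
    have "complex_jacobian g 0 ** complex_jacobian f 0 = mat 1"
      using jacobian_inverse_mult[OF bih \<open>open B\<close> \<open>0 \<in> B\<close>] by (simp add: f0 g_def)
    then have "complex_jacobian g 0 = mat 1"
      by (simp add: J0)
    moreover have "\<Phi> (0, t) = 0" "(0, t) \<in> W" for t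
      using imageI[OF \<open>0 \<in> B\<close>, of f] by (simp_all add: W_def \<Phi>_def f0)
    ultimately have "deriv (\<lambda>\<zeta>. F \<zeta> t) 0 = 1 + t" for t
      using DERIV_imp_deriv[OF d\<zeta>[of 0 t]]
      by (simp add: J0 cinner_add_left cinner_scale_left cinner_self \<open>norm u = 1\<close>)
    then show "((\<lambda>t. deriv (\<lambda>\<zeta>. F \<zeta> t) 0) has_field_derivative 1) (at 0)"
      by (auto intro!: derivative_eq_intros)
  qed (use dt d\<zeta> field_differentiable_def W0 in \<open>(blast | simp)+\<close>)
  define p where "p \<zeta> = (if \<zeta> = 0 then deriv q 0 else (q \<zeta> - q 0) / \<zeta>)" for \<zeta>
  have "q 0 = 0"
    using q[of 0] by (simp add: f0)
  \<comment> \<open>Dividing by \<zeta> agrees with pairing with \<open>\<zeta> *s u\<close> and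
    dividing by |\<zeta>|^2, because the conjugate of \<zeta> over |\<zeta>|^2 is 1/\<zeta>.\<close>
  have p_eq: "p \<zeta> = cinner (matrix_inv (complex_jacobian f (\<zeta> *s u)) *v f (\<zeta> *s u)) (\<zeta> *s u)
      / of_real ((norm (\<zeta> *s u))\<^sup>2)" if "cmod \<zeta> < 1" "\<zeta> \<noteq> 0" for \<zeta>
    using that \<open>q 0 = 0\<close> q
    by (simp add: p_def cinner_scale_right norm_vector_scalar \<open>norm u = 1\<close> complex_norm_square
        del: of_real_power)
  have "\<exists>\<omega>. cmod \<omega> \<le> cmod (of_real (norm z)) \<and>
      p (of_real (norm z)) * (1 + of_real (1 - 2 * \<gamma>) * \<omega>) = 1 - \<omega>"
  proof (rule moebius_schwarz)
    show "p holomorphic_on ball 0 1"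
      using pole_lemma[OF holq, of 0] by (simp add: p_def[abs_def] cong: if_cong)
    show "p 0 = 1"
      by (simp add: p_def \<open>deriv q 0 = 1\<close>)
    show "\<bar>1 - 2 * \<gamma>\<bar> < 1" "cmod (of_real (norm z)) < 1"
      using \<gamma> z by auto
    show "\<exists>\<omega>. cmod \<omega> < 1 \<and> p \<zeta> = (1 - \<omega>) / (1 + of_real (1 - 2 * \<gamma>) * \<omega>)" if "cmod \<zeta> < 1" for \<zeta>
    proof (cases "\<zeta> = 0")
      case True
      then show ?thesis
        using \<open>p 0 = 1\<close> by (intro exI[of _ 0]) simp
    next
      case False
      then have "\<zeta> *s u \<noteq> 0"
        using \<open>norm u = 1\<close> by auto
      with range[of "\<zeta> *s u"] line that False p_eq show ?thesis
        by (auto simp: image_iff)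
    qed
  qed
  then show ?thesis
    using p_eq[of "of_real (norm z)"] z by (simp flip: z_u)
qed

text \<open>Solving the relation for \<omega> gives |1-P| <= r|1+cP|. Once \<open>1 + c * P\<close>
  is known to be positive this is a pair of linear inequalities in P, whose endpoints are the values
  at \<omega> = r and \<omega> = -r.\<close>

lemma real_moebius_bounds:
  fixes P c r :: real
  assumes r: "0 < r" "r < 1" and c: "\<bar>c\<bar> < 1"
    and \<omega>: "cmod \<omega> \<le> r" "of_real P * (1 + of_real c * \<omega>) = 1 - \<omega>"
  shows "P > 0" "(1 - r) / (1 + c * r) \<le> P" "P \<le> (1 + r) / (1 - c * r)"
proof -
  have "\<omega> * of_real (1 + c * P) = of_real (1 - P)"
    using \<omega>(2) by (simp add: algebra_simps)
  then have "cmod \<omega> * \<bar>1 + c * P\<bar> = \<bar>1 - P\<bar>"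
    by (metis norm_mult norm_of_real)
  then have le: "\<bar>1 - P\<bar> \<le> r * \<bar>1 + c * P\<bar>"
    using \<omega>(1) by (metis abs_ge_zero mult_right_mono)
  have cr: "\<bar>c * r\<bar> < 1"
    using mult_strict_mono'[of "\<bar>c\<bar>" 1 r 1] c r by (simp add: abs_mult)
  show "P > 0"
  proof (rule ccontr)
    assume "\<not> P > 0"
    then have "\<bar>c * P\<bar> \<le> 1 * (- P)"
      unfolding abs_mult using c by (intro mult_mono) auto
    then have "\<bar>1 + c * P\<bar> \<le> 1 - P" by linarith
    then have "\<bar>1 - P\<bar> \<le> r * (1 - P)"
      using le r by (meson mult_left_mono order_trans less_imp_le)
    also have "\<dots> < 1 * (1 - P)"
      using r \<open>\<not> P > 0\<close> by (intro mult_strict_right_mono) auto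
    finally show False by simp
  qed
  \<comment> \<open>Otherwise the inequality would force P <= 1, and then |c| P < 1 contradicts the
    assumed sign.\<close>
  have "1 + c * P > 0"
  proof (rule ccontr)
    assume "\<not> 1 + c * P > 0"
    then have "\<bar>1 + c * P\<bar> = - 1 - c * P"
      by linarith
    with le have "P - 1 \<le> r * (- 1 - c * P)"
      by simp
    then have "P * (1 + c * r) \<le> 1 - r"
      by (simp add: algebra_simps)
    also have "\<dots> \<le> 1 * (1 + c * r)"
      using c r mult_right_mono[of "- 1" c r] by (simp add: abs_less_iff)
    finally have "P \<le> 1"
      using cr by (simp add: abs_less_iff)
    then have "\<bar>c\<bar> * P < 1"
      using c mult_left_mono[of P 1 "\<bar>c\<bar>"] by simp
    then have "- (c * P) < 1"
      using abs_ge_minus_self[of "c * P"] \<open>P > 0\<close> by (simp add: abs_mult)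
    with \<open>\<not> 1 + c * P > 0\<close> show False
      by simp
  qed
  with le have "1 - P \<le> r * (1 + c * P)" "P - 1 \<le> r * (1 + c * P)"
    by simp_all
  then show "(1 - r) / (1 + c * r) \<le> P" "P \<le> (1 + r) / (1 - c * r)"
    using cr by (simp_all add: divide_le_eq le_divide_eq algebra_simps abs_less_iff)
qed

text \<open>A failure of \<open>N \<le> a\<close> would make \<open>N(\<xi>) - a(\<bar>\<xi>\<bar>) - e \<bar>\<xi>\<bar>\<close> maximal over an annulus at some point
  off its inner boundary; that point maximizes \<open>N\<close> on its sphere, yet moving it towards the
  origin increases the function.\<close>

lemma sphere_max_comparison:
  fixes N :: "'a :: euclidean_space \<Rightarrow> real" and a a' :: "real \<Rightarrow> real"
  assumes cont: "continuous_on (ball 0 1 - {0}) N"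
    and a: "\<And>\<rho>. 0 < \<rho> \<Longrightarrow> \<rho> < 1 \<Longrightarrow> (a has_real_derivative a' \<rho>) (at \<rho>)"
    and crit: "\<And>z. z \<in> ball 0 1 - {0} \<Longrightarrow> (\<And>\<xi>. norm \<xi> = norm z \<Longrightarrow> N \<xi> \<le> N z) \<Longrightarrow>
      \<exists>D. ((\<lambda>t. N (t *\<^sub>R z)) has_real_derivative D) (at 1) \<and> D \<le> norm z * a' (norm z)"
    and lim: "((\<lambda>\<xi>. N \<xi> - a (norm \<xi>)) \<longlongrightarrow> 0) (at 0)"
    and z: "z \<in> ball 0 1 - {0}"
  shows "N z \<le> a (norm z)"
proof (rule field_le_epsilon)
  fix e' :: real assume "e' > 0"
  define e where "e = e' / 2"
  have "e > 0"
    using \<open>e' > 0\<close> by (simp add: e_def)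
  define r where "r = norm z"
  have r: "0 < r" "r < 1"
    using z by (auto simp: r_def)
  obtain d where d: "d > 0" "\<And>\<xi>. \<xi> \<noteq> 0 \<Longrightarrow> norm \<xi> < d \<Longrightarrow> \<bar>N \<xi> - a (norm \<xi>)\<bar> < e"
    using lim \<open>e > 0\<close> unfolding tendsto_iff eventually_at by (fastforce simp: dist_norm)
  \<comment> \<open>The inner radius lies inside the region where the limit hypothesis gives
    \<open>N - a < e\<close>; this settles the case of a maximum on the inner boundary.\<close>
  define \<epsilon> where "\<epsilon> = min (r / 2) (d / 2)"
  have \<epsilon>: "0 < \<epsilon>" "\<epsilon> < r" "\<epsilon> < d"
    using r d(1) by (auto simp: \<epsilon>_def)
  define K where "K = cball (0 :: 'a) r - ball 0 \<epsilon>"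
  have K: "K \<subseteq> ball 0 1 - {0}"
    using r \<epsilon> by (auto simp: K_def)
  define \<Psi> where "\<Psi> \<xi> = N \<xi> - a (norm \<xi>) - e * norm \<xi>" for \<xi>
  have "isCont a \<rho>" if "0 < \<rho>" "\<rho> < 1" for \<rho>
    using a[OF that] by (rule DERIV_isCont)
  then have "continuous_on {0<..<1} a"
    by (intro continuous_at_imp_continuous_on) auto
  then have "continuous_on K (\<lambda>\<xi>. a (norm \<xi>))"
    by (rule continuous_on_compose2) (use K in \<open>auto intro!: continuous_intros\<close>)
  then have "continuous_on K \<Psi>"
    unfolding \<Psi>_def[abs_def] by (intro continuous_intros continuous_on_subset[OF cont K])
  moreover have "compact K"
    unfolding K_def by (intro compact_diff) auto
  moreover have "z \<in> K"
    using \<epsilon> by (simp add: K_def r_def)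
  ultimately obtain x where x: "x \<in> K" and max: "\<And>y. y \<in> K \<Longrightarrow> \<Psi> y \<le> \<Psi> x"
    by (metis continuous_attains_sup empty_iff)
  define \<rho> where "\<rho> = norm x"
  have \<rho>: "\<epsilon> \<le> \<rho>" "\<rho> \<le> r"
    using x by (auto simp: K_def \<rho>_def)
  have "\<rho> = \<epsilon>"
  proof (rule ccontr)
    assume "\<rho> \<noteq> \<epsilon>"
    have "N \<xi> \<le> N x" if "norm \<xi> = norm x" for \<xi>
      using max[of \<xi>] that \<rho> by (simp add: K_def \<Psi>_def \<rho>_def)
    then obtain D where D: "((\<lambda>t. N (t *\<^sub>R x)) has_real_derivative D) (at 1)" "D \<le> \<rho> * a' \<rho>"
      using crit[of x] x K unfolding \<rho>_def by blast
    have "(a has_real_derivative a' \<rho>) (at (1 * \<rho>))"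
      using a \<rho> \<epsilon> r by simp
    then have "((\<lambda>t. a (t * \<rho>)) has_real_derivative a' \<rho> * \<rho>) (at 1)"
      by (rule DERIV_chain2) (auto intro!: derivative_eq_intros)
    then have der: "((\<lambda>t. N (t *\<^sub>R x) - a (t * \<rho>) - e * (t * \<rho>)) has_real_derivative
        D - a' \<rho> * \<rho> - e * \<rho>) (at 1)"
      by (auto intro!: derivative_eq_intros D(1))
    have neg: "D - a' \<rho> * \<rho> - e * \<rho> < 0"
      using D(2) \<open>e > 0\<close> \<rho> \<epsilon> by (smt (verit) mult.commute mult_pos_pos)
    obtain h0 where h0: "h0 > 0" "\<And>h. 0 < h \<Longrightarrow> h < h0 \<Longrightarrow>
        N (1 *\<^sub>R x) - a (1 * \<rho>) - e * (1 * \<rho>)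
        < N ((1 - h) *\<^sub>R x) - a ((1 - h) * \<rho>) - e * ((1 - h) * \<rho>)"
      using DERIV_neg_dec_left[OF der neg] by blast
    \<comment> \<open>The second bound keeps the shifted point outside the inner ball: (1-h)\<rho>
      >= \<epsilon>.\<close>
    define h where "h = min (h0 / 2) ((\<rho> - \<epsilon>) / \<rho>)"
    have "\<rho> > 0"
      using \<rho> \<epsilon> by linarith
    have "h \<le> h0 / 2" and "h \<le> (\<rho> - \<epsilon>) / \<rho>"
      unfolding h_def by (rule min.cobounded1, rule min.cobounded2)
    moreover have "0 < h"
      using h0(1) \<rho> \<open>\<rho> > 0\<close> \<open>\<rho> \<noteq> \<epsilon>\<close> by (simp add: h_def)
    ultimately have h: "0 < h" "h < h0"
      using h0(1) by simp_all
    have h\<rho>: "\<epsilon> \<le> (1 - h) * \<rho>"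
      using \<open>h \<le> (\<rho> - \<epsilon>) / \<rho>\<close> \<open>\<rho> > 0\<close> by (simp add: le_divide_eq algebra_simps)
    then have "h < 1"
      using \<epsilon>(1) \<open>\<rho> > 0\<close> by (smt (verit) mult_nonneg_nonneg mult_nonpos_nonneg)
    then have norm_x: "norm ((1 - h) *\<^sub>R x) = (1 - h) * \<rho>"
      by (simp add: \<rho>_def)
    moreover have "(1 - h) * \<rho> \<le> 1 * \<rho>"
      using h \<open>\<rho> > 0\<close> by (intro mult_right_mono) auto
    ultimately have "(1 - h) *\<^sub>R x \<in> K"
      using h\<rho> \<rho> by (simp add: K_def)
    from max[OF this] h0(2)[OF h] show False
      unfolding \<Psi>_def norm_x by (simp add: \<rho>_def)
  qed
  then have "x \<noteq> 0" "norm x < d"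
    using \<epsilon> by (auto simp: \<rho>_def)
  then have "N x - a (norm x) < e"
    using d(2)[of x] by linarith
  moreover have "0 \<le> e * norm x"
    using \<open>e > 0\<close> by simp
  ultimately have "\<Psi> x \<le> e"
    unfolding \<Psi>_def by linarith
  then have "\<Psi> z \<le> e"
    using max[OF \<open>z \<in> K\<close>] by linarith
  \<comment> \<open>The two contributions, \<open>e\<close> from the inner boundary and at most
    \<open>e\<close> from the penalty term, add up to \<open>e'\<close>.\<close>
  moreover have "e * r \<le> e * 1"
    using r \<open>e > 0\<close> by (intro mult_left_mono) auto
  ultimately show "N z \<le> a (norm z) + e'"
    by (simp add: \<Psi>_def e_def r_def)
qed

lemma norm_quotient_tendsto_1:
  fixes f :: "'a :: real_normed_vector \<Rightarrow> 'a"
  assumes "(f has_derivative (\<lambda>h. h)) (at 0)" "f 0 = 0"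
  shows "((\<lambda>\<xi>. norm (f \<xi>) / norm \<xi>) \<longlongrightarrow> 1) (at 0)"
proof -
  have "((\<lambda>\<xi>. norm (f \<xi> - \<xi>) / norm \<xi>) \<longlongrightarrow> 0) (at 0)"
    using assms by (simp add: has_derivative_at)
  moreover have "\<forall>\<^sub>F \<xi> in at 0. norm (norm (f \<xi>) / norm \<xi> - 1) \<le> norm (f \<xi> - \<xi>) / norm \<xi>"
  proof (rule eventually_at_filter[THEN iffD2], rule always_eventually, intro allI impI)
    fix \<xi> :: 'a assume "\<xi> \<noteq> 0"
    then have "norm (f \<xi>) / norm \<xi> - 1 = (norm (f \<xi>) - norm \<xi>) / norm \<xi>"
      by (simp add: field_simps)
    then show "norm (norm (f \<xi>) / norm \<xi> - 1) \<le> norm (f \<xi> - \<xi>) / norm \<xi>"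
      by (simp add: divide_right_mono norm_triangle_ineq3)
  qed
  ultimately have "((\<lambda>\<xi>. norm (f \<xi>) / norm \<xi> - 1) \<longlongrightarrow> 0) (at 0)"
    by (rule Lim_null_comparison[rotated])
  then show ?thesis
    by (simp add: LIM_zero_iff)
qed

text \<open>The quotient bounded here is \<open>\<langle>J_f(z)\<^sup>-\<^sup>1 f(z), z\<rangle> / \<bar>z\<bar>\<^sup>2\<close>, which is real at an extremal point.\<close>

lemma starlike_extremal_point:
  fixes f :: "complex ^ 'n \<Rightarrow> complex ^ 'n"
  assumes \<gamma>: "0 < \<gamma>" "\<gamma> < 1" and f: "starlike_of_order \<gamma> f"
    and z: "z \<in> ball 0 1 - {0}"
    and extremal: "(\<forall>q. norm q = norm z \<longrightarrow> norm (f q) \<le> norm (f z))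
      \<or> (\<forall>q. norm q = norm z \<longrightarrow> norm (f z) \<le> norm (f q))"
  obtains l :: real where
    "\<And>v. cinner (complex_jacobian f z *v v) (f z) = of_real l * cinner v z" "l > 0"
    "(1 - norm z) / (1 + (1 - 2 * \<gamma>) * norm z) \<le> (norm (f z))\<^sup>2 / (l * (norm z)\<^sup>2)"
    "(norm (f z))\<^sup>2 / (l * (norm z)\<^sup>2) \<le> (1 + norm z) / (1 - (1 - 2 * \<gamma>) * norm z)"
proof -
  have bih: "biholomorphic_map_on f (ball 0 1)" and f0: "f 0 = 0"
    using f by (auto simp: starlike_of_order_def normalized_map_def)
  have fz: "f z \<noteq> 0"
    using bih z f0 by (auto simp: biholomorphic_map_on_def inj_on_def)
  have "(f has_derivative (\<lambda>h. complex_jacobian f z *v h)) (at z)"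
    using bih z by (auto simp: biholomorphic_map_on_def intro: has_derivative_complex_jacobian)
  then obtain l where adj: "\<And>v. cinner (complex_jacobian f z *v v) (f z) = of_real l * cinner v z"
    using extremal_multiplier[of f _ z] extremal z by blast
  define h where "h = matrix_inv (complex_jacobian f z) *v f z"
  have "complex_jacobian f z ** matrix_inv (complex_jacobian f z) = mat 1"
    using jacobian_inverse_mult[OF bih, of z] matrix_inv_jacobian[OF bih, of z] z
    by (simp add: matrix_left_right_inverse)
  then have "complex_jacobian f z *v h = f z"
    by (simp add: h_def matrix_vector_mul_assoc)
  \<comment> \<open>Pairing J h = f(z) with f(z) expresses \<open>cinner h z\<close> through the
    real multiplier, so the quotient is the real number \<open>P\<close>.\<close>
  with adj[of h] have l_h: "of_real ((norm (f z))\<^sup>2) = of_real l * cinner h z"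
    by (simp add: cinner_self)
  have "l \<noteq> 0"
    using l_h fz by auto
  define P where "P = (norm (f z))\<^sup>2 / (l * (norm z)\<^sup>2)"
  have "cinner h z / of_real ((norm z)\<^sup>2) = of_real P"
    using l_h \<open>l \<noteq> 0\<close> z by (simp add: P_def field_simps)
  then obtain \<omega> where \<omega>: "cmod \<omega> \<le> norm z" "of_real P * (1 + of_real (1 - 2 * \<gamma>) * \<omega>) = 1 - \<omega>"
    using starlike_radial_schwarz[OF \<gamma> f z] unfolding h_def by auto
  have "0 < norm z" "norm z < 1" "\<bar>1 - 2 * \<gamma>\<bar> < 1"
    using \<gamma> z by auto
  note P = real_moebius_bounds[OF this \<omega>]
  have "l > 0"
    using P(1) fz by (simp add: P_def zero_less_divide_iff zero_less_mult_iff)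
  show thesis
    using that[OF adj \<open>l > 0\<close> P(2,3)[unfolded P_def]] .
qed

text \<open>At an extremal point of |f| on a sphere, t -> ln |f(tx)| has derivative 1/P at 1, with P
  as in the Schwarz estimate. The bounds on 1/P are \<rho> times the derivatives of ln \<rho> -
  \<beta> ln(1-\<rho>) and ln \<rho> - \<beta> ln(1+\<rho>), where
  \<open>\<beta> = 2 * (1 - \<gamma>)\<close>. Comparison with these functions, calibrated at 0 by
  the normalization, gives both estimates.\<close>

lemma starlike_growth:
  fixes f :: "complex ^ 'n \<Rightarrow> complex ^ 'n"
  assumes \<gamma>: "0 < \<gamma>" "\<gamma> < 1" and f: "starlike_of_order \<gamma> f"
    and z: "z \<in> ball 0 1 - {0}"
  shows "norm (f z) \<le> norm z * (1 - norm z) powr (2 * (\<gamma> - 1))"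
    and "norm z * (1 + norm z) powr (2 * (\<gamma> - 1)) \<le> norm (f z)"
proof -
  define \<beta> where "\<beta> = 2 * (1 - \<gamma>)"
  define N where "N \<xi> = ln (norm (f \<xi>))" for \<xi>
  have bih: "biholomorphic_map_on f (ball 0 1)" and f0: "f 0 = 0" and J0: "complex_jacobian f 0 = mat 1"
    using f by (auto simp: starlike_of_order_def normalized_map_def)
  then have hol: "holomorphic_map_on f (ball 0 1)" and inj: "inj_on f (ball 0 1)"
    by (auto simp: biholomorphic_map_on_def)
  have fnz: "f \<xi> \<noteq> 0" if "\<xi> \<in> ball 0 1 - {0}" for \<xi>
    using inj that f0 by (auto simp: inj_on_def)
  have cont: "continuous_on (ball 0 1 - {0}) N"
    unfolding N_def using fnz
    by (intro continuous_intros continuous_on_subset[OF holomorphic_map_on_imp_continuous_on[OF hol]]) auto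
  have "(f has_derivative (\<lambda>h. h)) (at 0)"
    using has_derivative_complex_jacobian[OF hol, of 0] by (simp add: J0)
  then have "((\<lambda>\<xi>. norm (f \<xi>) / norm \<xi>) \<longlongrightarrow> 1) (at 0)"
    using f0 by (rule norm_quotient_tendsto_1)
  then have "((\<lambda>\<xi>. ln (norm (f \<xi>) / norm \<xi>)) \<longlongrightarrow> ln 1) (at 0)"
    by (rule tendsto_ln) simp
  moreover have "\<forall>\<^sub>F \<xi> in at 0. ln (norm (f \<xi>) / norm \<xi>) = N \<xi> - ln (norm \<xi>)"
  proof -
    have "\<forall>\<^sub>F \<xi> in at 0. \<xi> \<in> ball 0 1 - {0 :: complex ^ 'n}"
      by (auto simp: eventually_at dist_norm intro!: exI[of _ 1])
    then show ?thesis
      by eventually_elim (use fnz in \<open>auto simp: N_def ln_div\<close>)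
  qed
  ultimately have limN: "((\<lambda>\<xi>. N \<xi> - ln (norm \<xi>)) \<longlongrightarrow> 0) (at 0)"
    by (simp add: tendsto_cong)
  have radial: "((\<lambda>t. N (t *\<^sub>R x)) has_real_derivative l * (norm x)\<^sup>2 / (norm (f x))\<^sup>2) (at 1)"
    if x: "x \<in> ball 0 1 - {0}"
      and adj: "\<And>v. cinner (complex_jacobian f x *v v) (f x) = of_real l * cinner v x" for x l
  proof -
    have d2: "((\<lambda>t. (norm (f (t *\<^sub>R x)))\<^sup>2) has_real_derivative 2 * (l * (norm x)\<^sup>2)) (at 1)"
      using radial_derivative_power2_norm[OF has_derivative_complex_jacobian[OF hol, of x]] x adj
      by (simp add: cinner_self)
    have "(ln has_real_derivative 1 / (norm (f x))\<^sup>2) (at ((norm (f (1 *\<^sub>R x)))\<^sup>2))"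
      using fnz[OF x] DERIV_ln_divide[of "(norm (f x))\<^sup>2"] by simp
    from DERIV_cdivide[OF DERIV_chain2[OF this d2], of 2]
    have "((\<lambda>t. ln ((norm (f (t *\<^sub>R x)))\<^sup>2) / 2) has_real_derivative
        l * (norm x)\<^sup>2 / (norm (f x))\<^sup>2) (at 1)"
      by simp
    moreover have "ln ((norm (f (t *\<^sub>R x)))\<^sup>2) / 2 = N (t *\<^sub>R x)" for t
      by (simp add: N_def ln_realpow)
    ultimately show ?thesis by simp
  qed
  define r where "r = norm z"
  have r: "0 < r" "r < 1"
    using z by (auto simp: r_def)
  have "norm (f z) > 0"
    using fnz[OF z] by simp
  have "N z \<le> ln (norm z) - \<beta> * ln (1 - norm z)"
  proof (rule sphere_max_comparison[OF cont _ _ _ z, where a' = "\<lambda>\<rho>. 1 / \<rho> + \<beta> / (1 - \<rho>)"])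
    show "((\<lambda>\<rho>. ln \<rho> - \<beta> * ln (1 - \<rho>)) has_real_derivative 1 / \<rho> + \<beta> / (1 - \<rho>)) (at \<rho>)"
      if "0 < \<rho>" "\<rho> < 1" for \<rho>
      using that by (auto intro!: derivative_eq_intros simp: field_simps)
    have "((\<lambda>\<xi>::complex ^ 'n. \<beta> * ln (1 - norm \<xi>)) \<longlongrightarrow> \<beta> * ln (1 - norm (0 :: complex ^ 'n))) (at 0)"
      by (intro tendsto_intros) auto
    from tendsto_add[OF limN this]
    show "((\<lambda>\<xi>. N \<xi> - (ln (norm \<xi>) - \<beta> * ln (1 - norm \<xi>))) \<longlongrightarrow> 0) (at 0)"
      by (simp add: algebra_simps)
  next
    fix x :: "complex ^ 'n"
    assume x: "x \<in> ball 0 1 - {0}" and max: "\<And>\<xi>. norm \<xi> = norm x \<Longrightarrow> N \<xi> \<le> N x"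
    have \<rho>: "0 < norm x" "norm x < 1"
      using x by auto
    have "norm (f q) \<le> norm (f x)" if "norm q = norm x" for q
    proof -
      have "q \<in> ball 0 1 - {0}"
        using that x by auto
      with max[OF that] fnz x show ?thesis
        by (simp add: N_def)
    qed
    then obtain l where l: "\<And>v. cinner (complex_jacobian f x *v v) (f x) = of_real l * cinner v x" "l > 0"
        "(1 - norm x) / (1 + (1 - 2 * \<gamma>) * norm x) \<le> (norm (f x))\<^sup>2 / (l * (norm x)\<^sup>2)"
      using starlike_extremal_point[OF \<gamma> f x] by blast
    have "\<bar>(1 - 2 * \<gamma>) * norm x\<bar> < 1 * 1"
      unfolding abs_mult using \<gamma> \<rho> by (intro mult_strict_mono') auto
    then have pos: "1 + (1 - 2 * \<gamma>) * norm x > 0"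
      by linarith
    have "l * (norm x)\<^sup>2 / (norm (f x))\<^sup>2 = inverse ((norm (f x))\<^sup>2 / (l * (norm x)\<^sup>2))"
      by (simp add: field_simps)
    also have "\<dots> \<le> inverse ((1 - norm x) / (1 + (1 - 2 * \<gamma>) * norm x))"
      using l(3) pos \<rho> by (intro le_imp_inverse_le) auto
    also have "\<dots> = norm x * (1 / norm x + \<beta> / (1 - norm x))"
      using \<rho> by (simp add: \<beta>_def field_simps)
    finally show "\<exists>D. ((\<lambda>t. N (t *\<^sub>R x)) has_real_derivative D) (at 1)
        \<and> D \<le> norm x * (1 / norm x + \<beta> / (1 - norm x))"
      using radial[OF x l(1)] by blast
  qed
  then have "exp (N z) \<le> exp (ln r - \<beta> * ln (1 - r))"
    by (simp add: r_def)
  moreover have "ln r - \<beta> * ln (1 - r) = ln r + 2 * (\<gamma> - 1) * ln (1 - r)"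
    by (simp add: \<beta>_def algebra_simps)
  ultimately show "norm (f z) \<le> norm z * (1 - norm z) powr (2 * (\<gamma> - 1))"
    using \<open>norm (f z) > 0\<close> r
    by (simp add: N_def powr_def exp_add flip: r_def)
  \<comment> \<open>The lower bound is the same comparison for \<open>- N\<close>, whose sphere
    maxima are the minima of |f|.\<close>
  have "- N z \<le> - (ln (norm z) - \<beta> * ln (1 + norm z))"
  proof (rule sphere_max_comparison[OF _ _ _ _ z, where N = "\<lambda>\<xi>. - N \<xi>"
        and a = "\<lambda>\<rho>. - (ln \<rho> - \<beta> * ln (1 + \<rho>))" and a' = "\<lambda>\<rho>. - (1 / \<rho> - \<beta> / (1 + \<rho>))"])
    show "continuous_on (ball 0 1 - {0}) (\<lambda>\<xi>. - N \<xi>)"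
      by (intro continuous_intros cont)
    show "((\<lambda>\<rho>. - (ln \<rho> - \<beta> * ln (1 + \<rho>))) has_real_derivative - (1 / \<rho> - \<beta> / (1 + \<rho>))) (at \<rho>)"
      if "0 < \<rho>" "\<rho> < 1" for \<rho>
      by (rule DERIV_minus) (use that in \<open>auto intro!: derivative_eq_intros simp: field_simps\<close>)
    have "((\<lambda>\<xi>::complex ^ 'n. \<beta> * ln (1 + norm \<xi>)) \<longlongrightarrow> \<beta> * ln (1 + norm (0 :: complex ^ 'n))) (at 0)"
      by (intro tendsto_intros) auto
    from tendsto_minus[OF tendsto_add[OF limN this]]
    show "((\<lambda>\<xi>. - N \<xi> - - (ln (norm \<xi>) - \<beta> * ln (1 + norm \<xi>))) \<longlongrightarrow> 0) (at 0)"
      by (simp add: algebra_simps)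
  next
    fix x :: "complex ^ 'n"
    assume x: "x \<in> ball 0 1 - {0}" and max: "\<And>\<xi>. norm \<xi> = norm x \<Longrightarrow> - N \<xi> \<le> - N x"
    have \<rho>: "0 < norm x" "norm x < 1"
      using x by auto
    have "norm (f x) \<le> norm (f q)" if "norm q = norm x" for q
    proof -
      have "q \<in> ball 0 1 - {0}"
        using that x by auto
      with max[OF that] fnz x show ?thesis
        by (simp add: N_def)
    qed
    then obtain l where l: "\<And>v. cinner (complex_jacobian f x *v v) (f x) = of_real l * cinner v x" "l > 0"
        "(norm (f x))\<^sup>2 / (l * (norm x)\<^sup>2) \<le> (1 + norm x) / (1 - (1 - 2 * \<gamma>) * norm x)"
      using starlike_extremal_point[OF \<gamma> f x] by blast
    have "\<rho> * (1 / \<rho> - \<beta> / (1 + \<rho>)) = inverse ((1 + \<rho>) / (1 - (1 - 2 * \<gamma>) * \<rho>))"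
      if "\<rho> > 0" for \<rho>
    proof -
      have "\<rho> * (1 / \<rho> - \<beta> / (1 + \<rho>)) = ((1 + \<rho>) - \<beta> * \<rho>) / (1 + \<rho>)"
        using that unfolding right_diff_distrib diff_divide_distrib by simp
      also have "(1 + \<rho>) - \<beta> * \<rho> = 1 - (1 - 2 * \<gamma>) * \<rho>"
        by (simp add: \<beta>_def algebra_simps)
      finally show ?thesis by simp
    qed
    from this[OF \<rho>(1)] have "norm x * (1 / norm x - \<beta> / (1 + norm x))
        = inverse ((1 + norm x) / (1 - (1 - 2 * \<gamma>) * norm x))" .
    also have "\<dots> \<le> inverse ((norm (f x))\<^sup>2 / (l * (norm x)\<^sup>2))"
      using l(2,3) \<rho> fnz[OF x] by (intro le_imp_inverse_le divide_pos_pos mult_pos_pos) auto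
    also have "\<dots> = l * (norm x)\<^sup>2 / (norm (f x))\<^sup>2"
      by (simp add: field_simps)
    finally have "- (l * (norm x)\<^sup>2 / (norm (f x))\<^sup>2) \<le> norm x * - (1 / norm x - \<beta> / (1 + norm x))"
      by (simp only: mult_minus_right neg_le_iff_le)
    with DERIV_minus[OF radial[OF x l(1)]]
    show "\<exists>D. ((\<lambda>t. - N (t *\<^sub>R x)) has_real_derivative D) (at 1)
        \<and> D \<le> norm x * - (1 / norm x - \<beta> / (1 + norm x))"
      by blast
  qed
  then have "exp (ln r - \<beta> * ln (1 + r)) \<le> exp (N z)"
    by (simp add: r_def)
  moreover have "ln r - \<beta> * ln (1 + r) = ln r + 2 * (\<gamma> - 1) * ln (1 + r)"
    by (simp add: \<beta>_def algebra_simps)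
  ultimately show "norm z * (1 + norm z) powr (2 * (\<gamma> - 1)) \<le> norm (f z)"
    using \<open>norm (f z) > 0\<close> r
    by (simp add: N_def powr_def exp_add flip: r_def)
qed

text \<open>Rewrites the stretching factor and the determinant bound in terms of the two quantities
  that are estimated separately, with Q = |f(z)|/|z| and P the quotient in the Schwarz
  estimate.\<close>

lemma multiplier_powr:
  fixes Q P l :: real
  assumes "Q > 0" "P > 0" "l = Q\<^sup>2 / P"
  shows "sqrt l = Q * P powr (- (1 / 2))"
    and "1 / Q * l powr ((real n + 1) / 2) = Q powr real n * P powr (- ((real n + 1) / 2))"
proof -
  have "sqrt l = Q / sqrt P"
    using assms by (simp add: real_sqrt_divide)
  then show "sqrt l = Q * P powr (- (1 / 2))"
    using assms powr_minus_divide[of P "1 / 2"] powr_half_sqrt[of P] by simp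
  have "l powr ((real n + 1) / 2) = (Q powr 2) powr ((real n + 1) / 2) / P powr ((real n + 1) / 2)"
    using assms by (simp add: powr_divide powr_numeral)
  also have "(Q powr 2) powr ((real n + 1) / 2) = Q powr real n * Q"
  proof -
    have "2 * (x / 2) = x" for x :: real
      by simp
    then show ?thesis
      using assms by (simp only: powr_powr powr_add powr_one)
  qed
  finally show "1 / Q * l powr ((real n + 1) / 2) = Q powr real n * P powr (- ((real n + 1) / 2))"
    using assms unfolding powr_minus_divide by simp
qed

theorem corollary3p6:
  fixes f :: "complex ^ 'n \<Rightarrow> complex ^ 'n" and \<gamma> :: real
  assumes "0 < \<gamma>" and "\<gamma> < 1" and "starlike_of_order \<gamma> f"
  shows
    "(\<forall>z\<in>ball 0 1 - {0}.
        (\<forall>\<xi>\<in>sphere 0 (norm z). norm (f \<xi>) \<le> norm (f z)) \<longrightarrow>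
          norm (det (complex_jacobian f z))
            \<le> (1 - norm z) powr (2 * (\<gamma> - 1) * real CARD('n))
              * ((1 - norm z) / (1 + (1 - 2 * \<gamma>) * norm z)) powr (- ((real CARD('n) + 1) / 2))
        \<and> (\<forall>\<delta>\<in>holomorphic_tangent_space z.
            norm (complex_jacobian f z *v \<delta>)
              \<le> (1 - norm z) powr (2 * (\<gamma> - 1))
                * ((1 - norm z) / (1 + (1 - 2 * \<gamma>) * norm z)) powr (- (1 / 2)) * norm \<delta>))
   \<and> (\<forall>z\<in>ball 0 1 - {0}.
        (\<forall>\<xi>\<in>sphere 0 (norm z). norm (f z) \<le> norm (f \<xi>)) \<longrightarrow>
          norm (det (complex_jacobian f z))
            \<ge> (1 + norm z) powr (- 2 * (1 - \<gamma>) * real CARD('n))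
              * ((1 + norm z) / (1 - (1 - 2 * \<gamma>) * norm z)) powr (- ((real CARD('n) + 1) / 2))
        \<and> (\<forall>\<delta>\<in>holomorphic_tangent_space z.
            norm (complex_jacobian f z *v \<delta>)
              \<ge> (1 + norm z) powr (- 2 * (1 - \<gamma>))
                * ((1 + norm z) / (1 - (1 - 2 * \<gamma>) * norm z)) powr (- (1 / 2)) * norm \<delta>))"
proof (intro conjI ballI impI)
  define B where "B = ball (0 :: complex ^ 'n) 1"
  define g where "g = inv_into B f"
  have bih: "biholomorphic_map_on f B" and f0: "f 0 = 0"
    using assms(3) by (auto simp: starlike_of_order_def normalized_map_def B_def)
  then have holf: "holomorphic_map_on f B" and inj: "inj_on f B" and opn: "open (f ` B)"
    and holg: "holomorphic_map_on g (f ` B)"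
    by (auto simp: biholomorphic_map_on_def g_def)
  have "open B"
    by (simp add: B_def)
  have g_f: "g (f x) = x" if "x \<in> B" for x
    using inj that by (simp add: g_def)
  have tangent: "cinner \<delta> z = 0" if "\<delta> \<in> holomorphic_tangent_space z" for \<delta> z :: "complex ^ 'n"
    using that by (simp add: holomorphic_tangent_space_def cinner_def mult.commute)
  have inverses: "complex_jacobian g (f z) ** complex_jacobian f z = mat 1"
      "complex_jacobian f z ** complex_jacobian g (f z) = mat 1" if "z \<in> B" for z
    using jacobian_inverse_mult[OF bih \<open>open B\<close> that]
    by (simp_all add: g_def matrix_left_right_inverse)
  have pos: "0 < norm z" "norm z < 1" "f z \<noteq> 0"
      "1 + (1 - 2 * \<gamma>) * norm z > 0" "1 - (1 - 2 * \<gamma>) * norm z > 0"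
    if "z \<in> ball 0 1 - {0}" for z
  proof -
    show "0 < norm z" "norm z < 1"
      using that by auto
    show "f z \<noteq> 0"
      using inj that f0 by (auto simp: inj_on_def B_def)
    have "\<bar>(1 - 2 * \<gamma>) * norm z\<bar> < 1 * 1"
      unfolding abs_mult using assms(1,2) that by (intro mult_strict_mono') auto
    then show "1 + (1 - 2 * \<gamma>) * norm z > 0" "1 - (1 - 2 * \<gamma>) * norm z > 0"
      by linarith+
  qed
  have growth: "norm (f z) / norm z \<le> (1 - norm z) powr (2 * (\<gamma> - 1))"
      "(1 + norm z) powr (- 2 * (1 - \<gamma>)) \<le> norm (f z) / norm z" if "z \<in> ball 0 1 - {0}" for z
    using starlike_growth[OF assms that] pos(1)[OF that] by (simp_all add: field_simps)

  {
    fix z :: "complex ^ 'n"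
    assume z: "z \<in> ball 0 1 - {0}" and max: "\<forall>\<xi>\<in>sphere 0 (norm z). norm (f \<xi>) \<le> norm (f z)"
    then have "z \<in> B"
      by (simp add: B_def)
    have max': "\<forall>q. norm q = norm z \<longrightarrow> norm (f q) \<le> norm (f z)"
      using max by simp
    define J where "J = complex_jacobian f z"
    define Q where "Q = norm (f z) / norm z"
    define Q1 where "Q1 = (1 - norm z) powr (2 * (\<gamma> - 1))"
    define P1 where "P1 = (1 - norm z) / (1 + (1 - 2 * \<gamma>) * norm z)"
    have Q: "0 < Q" "Q \<le> Q1"
      using pos[OF z] growth[OF z] by (auto simp: Q_def Q1_def)
    have "P1 > 0"
      using pos[OF z] by (simp add: P1_def)
    obtain l where adj: "\<And>v. cinner (J *v v) (f z) = of_real l * cinner v z" and "l > 0"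
      and l: "P1 \<le> (norm (f z))\<^sup>2 / (l * (norm z)\<^sup>2)"
      unfolding J_def P1_def using starlike_extremal_point[OF assms z disjI1[OF max']] by blast
    define P where "P = Q\<^sup>2 / l"
    have P: "P1 \<le> P" "0 < P"
      using l Q \<open>P1 > 0\<close> \<open>l > 0\<close> by (auto simp: P_def Q_def power_divide mult.commute)
    have "l = Q\<^sup>2 / P"
      using Q \<open>l > 0\<close> by (simp add: P_def)
    note powr_l = multiplier_powr[OF Q(1) P(2) this]
    have tang: "(norm (J *v \<delta>))\<^sup>2 \<le> l * (norm \<delta>)\<^sup>2" if "cinner \<delta> z = 0" for \<delta>
      unfolding J_def
    proof (rule tangential_derivative_bound[OF \<open>open B\<close> _ holf _ _ _ that])
      show "cball 0 (norm z) \<subseteq> B"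
        using z by (auto simp: B_def)
    qed (use z max adj in \<open>auto simp: J_def\<close>)
    have "J *v (complex_jacobian g (f z) *v f z) = f z"
      using inverses(2)[OF \<open>z \<in> B\<close>] by (simp add: matrix_vector_mul_assoc J_def)
    from norm_det_le_of_tangential_bound[OF adj tang \<open>l > 0\<close> _ _ this]
    have "cmod (det J) \<le> 1 / Q * l powr ((real CARD('n) + 1) / 2)"
      using z pos(3)[OF z] by (simp add: Q_def)
    also have "\<dots> = Q powr real CARD('n) * P powr (- ((real CARD('n) + 1) / 2))"
      by (rule powr_l)
    \<comment> \<open>The power of \<open>P\<close> has a negative exponent, so the lower bound
      \<open>P1\<close> for \<open>P\<close> yields an upper bound.\<close>
    also have "\<dots> \<le> Q1 powr real CARD('n) * P1 powr (- ((real CARD('n) + 1) / 2))"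
      using Q P \<open>P1 > 0\<close> by (intro mult_mono[OF powr_mono2 powr_mono2']) auto
    also have "Q1 powr real CARD('n) = (1 - norm z) powr (2 * (\<gamma> - 1) * real CARD('n))"
      by (simp add: Q1_def powr_powr)
    finally show "norm (det (complex_jacobian f z))
            \<le> (1 - norm z) powr (2 * (\<gamma> - 1) * real CARD('n))
              * ((1 - norm z) / (1 + (1 - 2 * \<gamma>) * norm z)) powr (- ((real CARD('n) + 1) / 2))"
      by (simp add: J_def P1_def)
    fix \<delta> assume "\<delta> \<in> holomorphic_tangent_space z"
    from tang[OF tangent[OF this]] have "norm (J *v \<delta>) \<le> sqrt (l * (norm \<delta>)\<^sup>2)"
      by (rule real_le_rsqrt)
    also have "\<dots> = Q * P powr (- (1 / 2)) * norm \<delta>"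
      by (simp add: real_sqrt_mult powr_l)
    also have "\<dots> \<le> Q1 * P1 powr (- (1 / 2)) * norm \<delta>"
      using Q P \<open>P1 > 0\<close> by (intro mult_mono powr_mono2') auto
    finally show "norm (complex_jacobian f z *v \<delta>)
              \<le> (1 - norm z) powr (2 * (\<gamma> - 1))
                * ((1 - norm z) / (1 + (1 - 2 * \<gamma>) * norm z)) powr (- (1 / 2)) * norm \<delta>"
      by (simp add: J_def Q1_def P1_def)
  next
    fix z :: "complex ^ 'n"
    assume z: "z \<in> ball 0 1 - {0}" and min: "\<forall>\<xi>\<in>sphere 0 (norm z). norm (f z) \<le> norm (f \<xi>)"
    then have "z \<in> B"
      by (simp add: B_def)
    have min': "\<forall>q. norm q = norm z \<longrightarrow> norm (f z) \<le> norm (f q)"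
      using min by simp
    define J where "J = complex_jacobian f z"
    define G where "G = complex_jacobian g (f z)"
    have GJ: "G *v (J *v v) = v" and JG: "J *v (G *v v) = v" for v
      using inverses[OF \<open>z \<in> B\<close>] by (simp_all add: matrix_vector_mul_assoc J_def G_def)
    define Q where "Q = norm (f z) / norm z"
    define Q2 where "Q2 = (1 + norm z) powr (- 2 * (1 - \<gamma>))"
    define P2 where "P2 = (1 + norm z) / (1 - (1 - 2 * \<gamma>) * norm z)"
    have "0 < Q2"
      unfolding Q2_def powr_gt_zero using pos(1)[OF z] by linarith
    moreover have "0 < Q"
      using pos[OF z] by (simp add: Q_def)
    ultimately have Q: "0 < Q" "Q2 \<le> Q" "0 < Q2"
      using growth(2)[OF z, folded Q_def Q2_def] by blast+
    have "P2 > 0"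
      using pos[OF z] by (simp add: P2_def add_pos_pos)
    obtain l where adj: "\<And>v. cinner (J *v v) (f z) = of_real l * cinner v z" and "l > 0"
      and l: "(norm (f z))\<^sup>2 / (l * (norm z)\<^sup>2) \<le> P2"
      unfolding J_def P2_def using starlike_extremal_point[OF assms z disjI2[OF min']] by blast
    define P where "P = Q\<^sup>2 / l"
    have P: "P \<le> P2" "0 < P"
    proof -
      show "P \<le> P2"
        using l by (simp add: P_def Q_def power_divide mult.commute)
      show "0 < P"
        using Q(1) \<open>l > 0\<close> by (simp add: P_def)
    qed
    have "l = Q\<^sup>2 / P"
      using Q \<open>l > 0\<close> by (simp add: P_def)
    note powr_l = multiplier_powr[OF Q(1) P(2) this]
    \<comment> \<open>The inverse map has the reciprocal multiplier at f(z), so the tangential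
      estimate for it becomes a lower estimate for \<open>f\<close>.\<close>
    have adj': "cinner (G *v v) (g (f z)) = of_real (1 / l) * cinner v (f z)" for v
      using adj[of "G *v v"] \<open>l > 0\<close> \<open>z \<in> B\<close> by (simp add: JG g_f)
    \<comment> \<open>Two uses: the inverse is defined on the closed ball of radius |f(z)|, and
      every point of its sphere has its preimage in the closed ball of radius |z|. The latter makes
      f(z) a maximum point of |g|.\<close>
    have sub: "cball 0 (norm (f z)) \<subseteq> f ` cball 0 (norm z)"
    proof (rule ball_subset_image)
      have "cball 0 (norm z) \<subseteq> B"
        using z by (auto simp: B_def)
      then show "continuous_on (cball 0 (norm z)) f"
        by (rule continuous_on_subset[OF holomorphic_map_on_imp_continuous_on[OF holf]])
      have "f ` ball 0 (norm z) = f ` B \<inter> g -` ball 0 (norm z)"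
        using z g_f by (force simp: B_def)
      then show "open (f ` ball 0 (norm z))"
        using continuous_open_preimage[OF holomorphic_map_on_imp_continuous_on[OF holg] opn]
        by simp
    qed (use f0 z pos[OF z] min in auto)
    have tang: "(norm (G *v v))\<^sup>2 \<le> 1 / l * (norm v)\<^sup>2" if "cinner v (f z) = 0" for v
      unfolding G_def
    proof (rule tangential_derivative_bound[OF opn _ holg _ _ _ that])
      show "cball 0 (norm (f z)) \<subseteq> f ` B"
        using sub z by (fastforce simp: B_def)
      show "norm (g q) \<le> norm (g (f z))" if q: "norm q = norm (f z)" for q
      proof -
        have "q \<in> f ` cball 0 (norm z)"
          using q by (intro subsetD[OF sub]) simp
        then obtain x where x: "q = f x" "norm x \<le> norm z"
          by auto
        then have "x \<in> B"
          using z by (simp add: B_def)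
        with x \<open>z \<in> B\<close> show ?thesis
          by (simp add: g_f)
      qed
    qed (use pos[OF z] adj' in \<open>auto simp: G_def\<close>)
    have "cmod (det G) \<le> norm (f z) / norm z * (1 / l) powr ((real CARD('n) + 1) / 2)"
      by (rule norm_det_le_of_tangential_bound[OF adj'[unfolded g_f[OF \<open>z \<in> B\<close>]] tang _ _ _ GJ])
        (use \<open>l > 0\<close> z pos(3)[OF z] in auto)
    then have "cmod (det G) * (1 / Q * l powr ((real CARD('n) + 1) / 2)) \<le> 1"
      using Q(1) \<open>l > 0\<close> by (simp add: powr_divide field_simps flip: Q_def)
    moreover have "cmod (det G) * cmod (det J) = 1"
      using inverses(1)[OF \<open>z \<in> B\<close>] by (metis G_def J_def det_I det_mul norm_mult norm_one)
    ultimately have "cmod (det G) * (1 / Q * l powr ((real CARD('n) + 1) / 2))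
        \<le> cmod (det G) * cmod (det J)" and "cmod (det G) > 0"
      by (auto simp: zero_less_norm_iff)
    \<comment> \<open>The upper bound for \<open>det G\<close> is inverted using
      \<open>det G * det J = 1\<close>.\<close>
    then have det_J: "1 / Q * l powr ((real CARD('n) + 1) / 2) \<le> cmod (det J)"
      by (rule mult_left_le_imp_le)
    have "(1 + norm z) powr (- 2 * (1 - \<gamma>) * real CARD('n)) = Q2 powr real CARD('n)"
      by (simp add: Q2_def powr_powr)
    then have "(1 + norm z) powr (- 2 * (1 - \<gamma>) * real CARD('n)) * P2 powr (- ((real CARD('n) + 1) / 2))
        \<le> Q powr real CARD('n) * P powr (- ((real CARD('n) + 1) / 2))"
      using Q P by (simp only:) (intro mult_mono[OF powr_mono2 powr_mono2'], auto)
    also have "\<dots> \<le> cmod (det J)"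
      using det_J unfolding powr_l .
    finally show "norm (det (complex_jacobian f z))
            \<ge> (1 + norm z) powr (- 2 * (1 - \<gamma>) * real CARD('n))
              * ((1 + norm z) / (1 - (1 - 2 * \<gamma>) * norm z)) powr (- ((real CARD('n) + 1) / 2))"
      by (simp add: J_def P2_def)
    fix \<delta> assume "\<delta> \<in> holomorphic_tangent_space z"
    \<comment> \<open>\<open>adj\<close> makes the image of a tangent vector at z tangent at f(z),
      so the bound for \<open>G\<close> applies to \<open>J *v \<delta>\<close>.\<close>
    then have "cinner (J *v \<delta>) (f z) = 0"
      by (simp add: adj tangent)
    from tang[OF this] have "l * (norm \<delta>)\<^sup>2 \<le> (norm (J *v \<delta>))\<^sup>2"
      using \<open>l > 0\<close> by (simp add: GJ field_simps)
    then have "sqrt (l * (norm \<delta>)\<^sup>2) \<le> norm (J *v \<delta>)"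
      by (rule real_le_lsqrt[rotated -1]) simp_all
    then have "Q * P powr (- (1 / 2)) * norm \<delta> \<le> norm (J *v \<delta>)"
      by (simp add: real_sqrt_mult powr_l)
    moreover have "Q2 * P2 powr (- (1 / 2)) * norm \<delta> \<le> Q * P powr (- (1 / 2)) * norm \<delta>"
      using Q P by (intro mult_mono powr_mono2') auto
    ultimately show "norm (complex_jacobian f z *v \<delta>)
              \<ge> (1 + norm z) powr (- 2 * (1 - \<gamma>))
                * ((1 + norm z) / (1 - (1 - 2 * \<gamma>) * norm z)) powr (- (1 / 2)) * norm \<delta>"
      by (simp add: J_def Q2_def P2_def)
  }
qed

end
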